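(* Let $\mathcal{H}$ be a separable Hilbert function space on a non-empty set $X$ such that the reproducing kernel of $\mathcal{H}$ is a normalized complete Pick kernel. Then $\mathcal{M}\cap\operatorname{Mult}(\mathcal{H}\odot\mathcal{H})$ is dense in $\mathcal{M}$ (in the norm of $\mathcal{H}\odot\mathcal{H}$) for every $\operatorname{Mult}(\mathcal{H}\odot\mathcal{H})$-invariant subspace $\mathcal{M}$ of $\mathcal{H}\odot\mathcal{H}$.
   Context: A Hilbert (Banach) function space on a set $X$ is a Hilbert (Banach) space $\mathcal{B}$ of complex-valued functions on $X$ such that each point evaluation is bounded on $\mathcal{B}$. Its multipliers are $\operatorname{Mult}(\mathcal{B})=\{\varphi:X\to\mathbb{C}:\varphi\mathcal{B}\subseteq\mathcal{B}\}$. A $\operatorname{Mult}(\mathcal{B})$-invariant subspace of $\mathcal{B}$ is a closed subspace $\mathcal{M}$ with $\varphi\mathcal{M}\subseteq\mathcal{M}$ for all $\varphi\in\operatorname{Mult}(\mathcal{B})$. The reproducing kernel $k$ of a Hilbert function space $\mathcal{H}$ satisfies $f(w)=\langle f,k_w\rangle$, $k_w(z)=k(z,w)$. A normalized complete Pick kernel is a reproducing kernel such that $k_{z_0}=1$ for some $z_0\in X$ and $k_w(z)=\frac{1}{1-u_w(z)}$, where $u_w(z)$ is positive definite, i.e. $\sum_{i,j}a_i\overline{a_j}u_{z_j}(z_i)\ge 0$ for all $n\in\mathbb{N}$, $z_1,\dots,z_n\in X$, $a_1,\dots,a_n\in\mathbb{C}$. The weak product is $\mathcal{H}\odot\mathcal{H}=\{\sum_{i=1}^\infty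 f_ig_i: f_i,g_i\in\mathcal{H},\ \sum_i\|f_i\|\|g_i\|<\infty\}$ with norm $\|h\|_{\mathcal{H}\odot\mathcal{H}}=\inf\{\sum_i\|f_i\|\|g_i\|: h=\sum_i f_ig_i\}$; it is a Banach function space on $X$. *)

theory Defs
  imports "HOL-Analysis.Analysis" "HOL-Library.Function_Algebras"
begin

text \<open>
  The set \<open>X\<close> is the type \<open>'x\<close>, which is non-empty as every HOL type. Functions on \<open>X\<close> are added
  and multiplied pointwise. A space of functions is given by its carrier
  \<open>B :: ('x \<Rightarrow> complex) set\<close> together with a norm or an inner product that is meaningful on \<open>B\<close> only.
\<close>

interpretation cfun: vector_space "\<lambda>(c::complex) (f::'x \<Rightarrow> complex) x. c * f x"
  by unfold_locales (auto simp: fun_eq_iff algebra_simps)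

text \<open>
  Outside \<open>B\<close> the distance is set to 0, because \<^locale>\<open>Metric_space\<close> demands symmetry and
  non-negativity on the whole type.
\<close>

definition norm_dist ::
    "('x \<Rightarrow> complex) set \<Rightarrow> (('x \<Rightarrow> complex) \<Rightarrow> real) \<Rightarrow> ('x \<Rightarrow> complex) \<Rightarrow> ('x \<Rightarrow> complex) \<Rightarrow> real" where
  "norm_dist B N f g = (if f \<in> B \<and> g \<in> B then N (f - g) else 0)"

definition norm_topology ::
    "('x \<Rightarrow> complex) set \<Rightarrow> (('x \<Rightarrow> complex) \<Rightarrow> real) \<Rightarrow> ('x \<Rightarrow> complex) topology" where
  "norm_topology B N = Metric_space.mtopology B (norm_dist B N)"

definition Mult :: "('x \<Rightarrow> complex) set \<Rightarrow> ('x \<Rightarrow> complex) set" where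
  "Mult B = {\<phi>. \<forall>f\<in>B. \<phi> * f \<in> B}"

definition invariant_subspace ::
    "('x \<Rightarrow> complex) set \<Rightarrow> (('x \<Rightarrow> complex) \<Rightarrow> real) \<Rightarrow> ('x \<Rightarrow> complex) set \<Rightarrow> bool" where
  "invariant_subspace B N M \<longleftrightarrow>
     cfun.subspace M \<and> closedin (norm_topology B N) M \<and> (\<forall>\<phi>\<in>Mult B. \<forall>f\<in>M. \<phi> * f \<in> M)"

definition ip_norm ::
    "(('x \<Rightarrow> complex) \<Rightarrow> ('x \<Rightarrow> complex) \<Rightarrow> complex) \<Rightarrow> ('x \<Rightarrow> complex) \<Rightarrow> real" where
  "ip_norm ip f = sqrt (Re (ip f f))"

locale hilbert_function_space =
  fixes H :: "('x \<Rightarrow> complex) set"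
    and ip :: "('x \<Rightarrow> complex) \<Rightarrow> ('x \<Rightarrow> complex) \<Rightarrow> complex"
  assumes subspace: "cfun.subspace H"
    and ip_add_left: "\<lbrakk>f \<in> H; g \<in> H; h \<in> H\<rbrakk> \<Longrightarrow> ip (f + g) h = ip f h + ip g h"
    and ip_scale_left: "\<lbrakk>f \<in> H; g \<in> H\<rbrakk> \<Longrightarrow> ip (\<lambda>x. c * f x) g = c * ip f g"
    and ip_commute: "\<lbrakk>f \<in> H; g \<in> H\<rbrakk> \<Longrightarrow> ip g f = cnj (ip f g)"
    and ip_nonneg: "f \<in> H \<Longrightarrow> ip f f \<in> \<real>\<^sub>\<ge>\<^sub>0"
    and ip_definite: "\<lbrakk>f \<in> H; ip f f = 0\<rbrakk> \<Longrightarrow> f = 0"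
    and complete: "Metric_space.mcomplete H (norm_dist H (ip_norm ip))"
    and evaluation_bounded: "\<exists>C. \<forall>f\<in>H. cmod (f x) \<le> C * ip_norm ip f"

text \<open>A kernel is written \<open>k z w\<close> for \<open>k(z,w)\<close>, so that \<open>k\<^sub>w\<close> is \<open>\<lambda>z. k z w\<close>.\<close>

definition reproducing_kernel ::
    "('x \<Rightarrow> complex) set \<Rightarrow> (('x \<Rightarrow> complex) \<Rightarrow> ('x \<Rightarrow> complex) \<Rightarrow> complex) \<Rightarrow>
     ('x \<Rightarrow> 'x \<Rightarrow> complex) \<Rightarrow> bool" where
  "reproducing_kernel H ip k \<longleftrightarrow>
     (\<forall>w. (\<lambda>z. k z w) \<in> H \<and> (\<forall>f\<in>H. f w = ip f (\<lambda>z. k z w)))"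

definition positive_definite :: "('x \<Rightarrow> 'x \<Rightarrow> complex) \<Rightarrow> bool" where
  "positive_definite u \<longleftrightarrow>
     (\<forall>(n::nat) (z::nat \<Rightarrow> 'x) (a::nat \<Rightarrow> complex).
        (\<Sum>i<n. \<Sum>j<n. a i * cnj (a j) * u (z i) (z j)) \<in> \<real>\<^sub>\<ge>\<^sub>0)"

text \<open>The condition \<open>u z w \<noteq> 1\<close> makes the quotient meaningful, as \<open>1 / 0 = 0\<close> in HOL.\<close>

definition normalized_complete_Pick :: "('x \<Rightarrow> 'x \<Rightarrow> complex) \<Rightarrow> bool" where
  "normalized_complete_Pick k \<longleftrightarrow>
     (\<exists>z0. (\<lambda>z. k z z0) = 1) \<and>
     (\<exists>u. positive_definite u \<and> (\<forall>z w. u z w \<noteq> 1 \<and> k z w = 1 / (1 - u z w)))"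

text \<open>
  The series \<open>\<Sum>i. f i * g i\<close> is taken pointwise on \<open>X\<close>; boundedness of the point evaluations makes
  it absolutely convergent at every point.
\<close>

definition weak_representation ::
    "('x \<Rightarrow> complex) set \<Rightarrow> (('x \<Rightarrow> complex) \<Rightarrow> ('x \<Rightarrow> complex) \<Rightarrow> complex) \<Rightarrow> ('x \<Rightarrow> complex) \<Rightarrow>
     (nat \<Rightarrow> 'x \<Rightarrow> complex) \<Rightarrow> (nat \<Rightarrow> 'x \<Rightarrow> complex) \<Rightarrow> bool" where
  "weak_representation H ip h f g \<longleftrightarrow>
     (\<forall>i. f i \<in> H \<and> g i \<in> H) \<and>
     summable (\<lambda>i. ip_norm ip (f i) * ip_norm ip (g i)) \<and>
     (\<forall>x. (\<lambda>i. f i x * g i x) sums h x)"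

definition weak_product ::
    "('x \<Rightarrow> complex) set \<Rightarrow> (('x \<Rightarrow> complex) \<Rightarrow> ('x \<Rightarrow> complex) \<Rightarrow> complex) \<Rightarrow>
     ('x \<Rightarrow> complex) set" where
  "weak_product H ip = {h. \<exists>f g. weak_representation H ip h f g}"

definition weak_norm ::
    "('x \<Rightarrow> complex) set \<Rightarrow> (('x \<Rightarrow> complex) \<Rightarrow> ('x \<Rightarrow> complex) \<Rightarrow> complex) \<Rightarrow>
     ('x \<Rightarrow> complex) \<Rightarrow> real" where
  "weak_norm H ip h =
     Inf {(\<Sum>i. ip_norm ip (f i) * ip_norm ip (g i)) | f g. weak_representation H ip h f g}"

end

theory Submission
  imports Defs
begin

text \<open>
  Let \<open>k = 1 / (1 - u)\<close> and, for \<open>g \<in> H\<close>, put \<open>v\<^sub>g(z) = \<langle>g, k\<^sub>z g\<rangle>\<close>. For \<open>h = \<Sum>\<^sub>w a\<^sub>w k\<^sub>w\<close> one has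
  \<open>2 Re (\<Sum>\<^sub>z cnj a\<^sub>z v\<^sub>g(z) h(z)) \<ge> \<parallel>gh\<parallel>\<^sup>2 + \<parallel>g\<parallel>\<^sup>2 \<parallel>h\<parallel>\<^sup>2\<close>. Indeed, the difference of the two sides is
  the quadratic form of the Schur product of \<open>k\<close> with the kernel
  \<open>Q(z,w) = u(z,w) \<langle>g k\<^sub>w, g k\<^sub>z\<rangle> - \<langle>u\<^sub>w g k\<^sub>w, u\<^sub>z g k\<^sub>z\<rangle>\<close>, which is positive because the functions \<open>u\<^sub>w\<close> form
  a row contraction (this only uses \<open>u k = k - 1 \<le> k\<close>).

  Given \<open>h = \<Sum>\<^sub>i f\<^sub>i g\<^sub>i\<close> in the weak product, balanced so that \<open>\<parallel>f\<^sub>i\<parallel> = \<parallel>g\<^sub>i\<parallel>\<close>, let \<open>S\<close> be the sum of all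
  \<open>v\<close> of \<open>f\<^sub>i\<close> and \<open>g\<^sub>i\<close>, and \<open>\<omega> = 1 / (1 + \<epsilon> S)\<close>. By duality the inequality shows that
  \<open>\<omega>\<close> is a contractive multiplier of \<open>H\<close> and that the columns \<open>(\<omega> f\<^sub>i)\<^sub>i\<close> and \<open>(\<omega> g\<^sub>i)\<^sub>i\<close> are bounded
  multipliers. Hence \<open>\<omega>\<^sup>2 h = \<Sum>\<^sub>i (\<omega> f\<^sub>i) (\<omega> g\<^sub>i)\<close> is a multiplier of the weak product, and it lies in every
  invariant subspace that contains \<open>h\<close>. As \<open>\<epsilon> \<rightarrow> 0\<close>, \<open>\<omega> \<rightarrow> 1\<close> pointwise, hence strongly on \<open>H\<close> because
  \<open>\<omega>\<close> is contractive, and so \<open>\<omega>\<^sup>2 h \<rightarrow> h\<close>.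
\<close>

section \<open>Norm and inner product\<close>

text \<open>Stated for an arbitrary \<open>N\<close>, so that it serves the Hilbert space norm as
  well as the weak product norm.\<close>

lemma norm_dist_metric:
  assumes diff: "\<And>f g. \<lbrakk>f \<in> B; g \<in> B\<rbrakk> \<Longrightarrow> f - g \<in> B"
    and nonneg: "\<And>f. f \<in> B \<Longrightarrow> 0 \<le> N f"
    and minus: "\<And>f. f \<in> B \<Longrightarrow> N (- f) = N f"
    and zero: "N 0 = 0"
    and definite: "\<And>f. \<lbrakk>f \<in> B; N f = 0\<rbrakk> \<Longrightarrow> f = 0"
    and triangle: "\<And>f g. \<lbrakk>f \<in> B; g \<in> B\<rbrakk> \<Longrightarrow> N (f + g) \<le> N f + N g"
  shows "Metric_space B (norm_dist B N)"
proof
  fix f g h :: "'a \<Rightarrow> complex"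
  show "0 \<le> norm_dist B N f g"
    using nonneg diff by (simp add: norm_dist_def)
  show "norm_dist B N f g = norm_dist B N g f"
    using minus[of "f - g"] diff by (simp add: norm_dist_def)
  show "norm_dist B N f g = 0 \<longleftrightarrow> f = g" if "f \<in> B" "g \<in> B"
    using that definite[of "f - g"] diff zero by (auto simp: norm_dist_def)
  show "norm_dist B N f h \<le> norm_dist B N f g + norm_dist B N g h"
    if "f \<in> B" "g \<in> B" "h \<in> B"
    using that triangle[of "f - g" "g - h"] diff by (simp add: norm_dist_def)
qed

context hilbert_function_space
begin

abbreviation nrm :: "('x \<Rightarrow> complex) \<Rightarrow> real" where
  "nrm \<equiv> ip_norm ip"

lemma zero_mem: "0 \<in> H" "(\<lambda>x. 0) \<in> H"
  using cfun.subspace_0[OF subspace] by (simp_all add: zero_fun_def)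

lemmas add_mem = cfun.subspace_add[OF subspace]
lemmas diff_mem = cfun.subspace_diff[OF subspace]
lemmas uminus_mem = cfun.subspace_neg[OF subspace]
lemmas scale_mem = cfun.subspace_scale[OF subspace]

lemma lincomb_mem: "(\<And>i. i \<in> I \<Longrightarrow> f i \<in> H) \<Longrightarrow> (\<lambda>x. \<Sum>i\<in>I. a i * f i x) \<in> H"
proof (induction I rule: infinite_finite_induct)
  case (insert i I)
  have "(\<lambda>x. \<Sum>j\<in>insert i I. a j * f j x) = (\<lambda>x. a i * f i x) + (\<lambda>x. \<Sum>j\<in>I. a j * f j x)"
    using insert.hyps by (simp add: fun_eq_iff)
  then show ?case
    using insert by (simp add: add_mem scale_mem)
qed (auto simp: zero_mem)

lemma ip_add_right: "\<lbrakk>f \<in> H; g \<in> H; h \<in> H\<rbrakk> \<Longrightarrow> ip h (f + g) = ip h f + ip h g"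
  by (metis ip_commute ip_add_left add_mem complex_cnj_add)

lemma ip_scale_right: "\<lbrakk>f \<in> H; g \<in> H\<rbrakk> \<Longrightarrow> ip g (\<lambda>x. c * f x) = cnj c * ip g f"
  by (metis ip_commute ip_scale_left scale_mem complex_cnj_mult)

lemma ip_minus_left: "\<lbrakk>f \<in> H; g \<in> H\<rbrakk> \<Longrightarrow> ip (- f) g = - ip f g"
  using ip_scale_left[of f g "-1"] by (simp add: fun_Compl_def)

lemma ip_minus_right: "\<lbrakk>f \<in> H; g \<in> H\<rbrakk> \<Longrightarrow> ip g (- f) = - ip g f"
  using ip_scale_right[of f g "-1"] by (simp add: fun_Compl_def)

lemma ip_diff_left: "\<lbrakk>f \<in> H; g \<in> H; h \<in> H\<rbrakk> \<Longrightarrow> ip (f - g) h = ip f h - ip g h"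
  using ip_add_left[of f "- g" h] by (simp add: ip_minus_left uminus_mem)

lemma ip_diff_right: "\<lbrakk>f \<in> H; g \<in> H; h \<in> H\<rbrakk> \<Longrightarrow> ip h (f - g) = ip h f - ip h g"
  using ip_add_right[of f "- g" h] by (simp add: ip_minus_right uminus_mem)

lemma ip_zero_left: "g \<in> H \<Longrightarrow> ip 0 g = 0" "g \<in> H \<Longrightarrow> ip (\<lambda>x. 0) g = 0"
  using ip_scale_left[of g g 0] by (simp_all add: zero_fun_def)

lemma ip_zero_right: "g \<in> H \<Longrightarrow> ip g 0 = 0" "g \<in> H \<Longrightarrow> ip g (\<lambda>x. 0) = 0"
  using ip_scale_right[of g g 0] by (simp_all add: zero_fun_def)

lemma ip_lincomb_left:
  assumes "\<And>i. i \<in> I \<Longrightarrow> f i \<in> H" "g \<in> H"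
  shows "ip (\<lambda>x. \<Sum>i\<in>I. a i * f i x) g = (\<Sum>i\<in>I. a i * ip (f i) g)"
  using assms
proof (induction I rule: infinite_finite_induct)
  case (insert i I)
  have "(\<lambda>x. \<Sum>j\<in>insert i I. a j * f j x) = (\<lambda>x. a i * f i x) + (\<lambda>x. \<Sum>j\<in>I. a j * f j x)"
    using insert.hyps by (simp add: fun_eq_iff)
  then show ?case
    using insert by (simp add: ip_add_left ip_scale_left scale_mem lincomb_mem)
qed (auto simp: ip_zero_left)

lemma ip_lincomb_right:
  assumes "\<And>i. i \<in> I \<Longrightarrow> f i \<in> H" "g \<in> H"
  shows "ip g (\<lambda>x. \<Sum>i\<in>I. a i * f i x) = (\<Sum>i\<in>I. cnj (a i) * ip g (f i))"
proof -
  have "ip g (\<lambda>x. \<Sum>i\<in>I. a i * f i x) = cnj (ip (\<lambda>x. \<Sum>i\<in>I. a i * f i x) g)"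
    using assms by (intro ip_commute lincomb_mem)
  also have "\<dots> = (\<Sum>i\<in>I. cnj (a i) * ip g (f i))"
    using assms by (simp add: ip_lincomb_left) (intro sum.cong refl, metis ip_commute)
  finally show ?thesis .
qed

lemma ip_self: "f \<in> H \<Longrightarrow> ip f f = of_real ((nrm f)\<^sup>2)"
  using ip_nonneg[of f] by (auto simp: ip_norm_def complex_nonneg_Reals_iff complex_eq_iff)

lemma nrm_sq: "f \<in> H \<Longrightarrow> (nrm f)\<^sup>2 = Re (ip f f)"
  using ip_self[of f] by simp

lemma nrm_nonneg: "f \<in> H \<Longrightarrow> 0 \<le> nrm f"
  using ip_nonneg[of f] by (auto simp: ip_norm_def complex_nonneg_Reals_iff)

lemma nrm_eq_0: "\<lbrakk>f \<in> H; nrm f = 0\<rbrakk> \<Longrightarrow> f = 0"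
  using ip_self[of f] ip_definite by simp

lemma nrm_zero: "nrm 0 = 0" "nrm (\<lambda>x. 0) = 0"
  using ip_zero_left zero_mem by (auto simp: ip_norm_def)

lemma Re_ip_commute: "\<lbrakk>f \<in> H; g \<in> H\<rbrakk> \<Longrightarrow> Re (ip g f) = Re (ip f g)"
  by (subst ip_commute[of f g]) simp_all

lemma nrm_add_sq: "\<lbrakk>f \<in> H; g \<in> H\<rbrakk> \<Longrightarrow> (nrm (f + g))\<^sup>2 = (nrm f)\<^sup>2 + (nrm g)\<^sup>2 + 2 * Re (ip f g)"
  by (simp add: nrm_sq add_mem ip_add_left ip_add_right Re_ip_commute)

lemma nrm_diff_sq: "\<lbrakk>f \<in> H; g \<in> H\<rbrakk> \<Longrightarrow> (nrm (f - g))\<^sup>2 = (nrm f)\<^sup>2 + (nrm g)\<^sup>2 - 2 * Re (ip f g)"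
  by (simp add: nrm_sq diff_mem ip_diff_left ip_diff_right Re_ip_commute)

lemma nrm_scale:
  assumes f: "f \<in> H"
  shows "nrm (\<lambda>x. c * f x) = cmod c * nrm f"
proof -
  have "ip (\<lambda>x. c * f x) (\<lambda>x. c * f x) = (c * cnj c) * ip f f"
    using f by (simp add: scale_mem ip_scale_left ip_scale_right)
  also have "c * cnj c = of_real ((cmod c)\<^sup>2)"
    by (rule complex_norm_square[symmetric])
  finally have "Re (ip (\<lambda>x. c * f x) (\<lambda>x. c * f x)) = (cmod c)\<^sup>2 * Re (ip f f)"
    by simp
  then show ?thesis
    by (simp add: ip_norm_def real_sqrt_mult)
qed

lemma nrm_minus: "f \<in> H \<Longrightarrow> nrm (- f) = nrm f"
  by (simp add: ip_norm_def ip_minus_left ip_minus_right uminus_mem)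

text \<open>For nonzero vectors this is the expansion of the squared norm of \<open>f\<close> times
  the norm of \<open>g\<close> minus \<open>g\<close> times the norm of \<open>f\<close>, which is
  nonnegative.\<close>

lemma Re_ip_le: "\<lbrakk>f \<in> H; g \<in> H\<rbrakk> \<Longrightarrow> Re (ip f g) \<le> nrm f * nrm g"
proof -
  assume f: "f \<in> H" and g: "g \<in> H"
  show ?thesis
  proof (cases "nrm f = 0 \<or> nrm g = 0")
    case True
    then show ?thesis using f g nrm_eq_0 ip_zero_left ip_zero_right nrm_zero
      by (metis mult_zero_left mult_zero_right order_refl zero_complex.simps(1))
  next
    case False
    let ?a = "nrm f" and ?b = "nrm g"
    have pos: "0 < ?a" "0 < ?b" using False nrm_nonneg f g by fastforce+
    let ?f = "\<lambda>x. of_real ?b * f x" and ?g = "\<lambda>x. of_real ?a * g x"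
    have "0 \<le> (nrm (?f - ?g))\<^sup>2" by simp
    also have "\<dots> = 2 * (?a * ?b) * (?a * ?b) - 2 * (?a * ?b) * Re (ip f g)"
      using f g pos by (simp add: nrm_diff_sq scale_mem nrm_scale ip_scale_left ip_scale_right)
        (simp add: algebra_simps power2_eq_square)
    finally have "(?a * ?b) * Re (ip f g) \<le> (?a * ?b) * (?a * ?b)" by simp
    then show ?thesis using pos by simp
  qed
qed

text \<open>A unimodular factor \<open>c\<close> makes the inner product real and nonnegative, so
  that the bound on real parts applies.\<close>

lemma cauchy_schwarz: "\<lbrakk>f \<in> H; g \<in> H\<rbrakk> \<Longrightarrow> cmod (ip f g) \<le> nrm f * nrm g"
proof -
  assume f: "f \<in> H" and g: "g \<in> H"
  obtain c where c: "cmod c = 1" "c * ip f g = of_real (cmod (ip f g))"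
  proof (cases "ip f g = 0")
    case False
    let ?z = "ip f g"
    have "cnj ?z / of_real (cmod ?z) * ?z = (?z * cnj ?z) / of_real (cmod ?z)"
      by simp
    also have "\<dots> = of_real ((cmod ?z)\<^sup>2 / cmod ?z)"
      by (simp only: complex_norm_square[symmetric] of_real_divide)
    also have "\<dots> = of_real (cmod ?z)"
      by (simp add: power2_eq_square)
    finally show ?thesis
      using False that[of "cnj ?z / of_real (cmod ?z)"] by (simp add: norm_divide)
  qed (use that[of 1] in auto)
  have "cmod (ip f g) = Re (ip (\<lambda>x. c * f x) g)"
    using c f g by (simp add: ip_scale_left)
  also have "\<dots> \<le> nrm f * nrm g"
    using Re_ip_le[of "\<lambda>x. c * f x" g] f g c by (simp add: scale_mem nrm_scale)
  finally show ?thesis .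
qed

lemma nrm_triangle: "\<lbrakk>f \<in> H; g \<in> H\<rbrakk> \<Longrightarrow> nrm (f + g) \<le> nrm f + nrm g"
proof (rule power2_le_imp_le)
  assume f: "f \<in> H" and g: "g \<in> H"
  show "(nrm (f + g))\<^sup>2 \<le> (nrm f + nrm g)\<^sup>2"
    using Re_ip_le[OF f g] by (simp add: nrm_add_sq f g power2_sum)
qed (simp add: nrm_nonneg)

lemma nrm_triangle_diff: "\<lbrakk>f \<in> H; g \<in> H\<rbrakk> \<Longrightarrow> nrm (f - g) \<le> nrm f + nrm g"
  using nrm_triangle[of f "- g"] by (simp add: uminus_mem nrm_minus)

lemma metric: "Metric_space H (norm_dist H nrm)"
  by (rule norm_dist_metric)
    (auto simp: diff_mem nrm_nonneg nrm_minus nrm_zero nrm_eq_0 nrm_triangle)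

lemma Cauchy_limit:
  assumes x: "\<And>n. x n \<in> H"
    and Cauchy: "\<And>e. e > 0 \<Longrightarrow> \<exists>N. \<forall>m\<ge>N. \<forall>n\<ge>N. nrm (x m - x n) < e"
  obtains l where "l \<in> H" "(\<lambda>n. nrm (x n - l)) \<longlonglongrightarrow> 0"
proof -
  interpret Metric_space H "norm_dist H nrm" by (rule metric)
  have "MCauchy x"
    using x Cauchy unfolding MCauchy_def norm_dist_def by (simp add: image_subset_iff)
  then obtain l where l: "limitin mtopology x l sequentially"
    using complete by (auto simp: mcomplete_def)
  then have "l \<in> H" "(\<lambda>n. norm_dist H nrm (x n) l) \<longlonglongrightarrow> 0"
    by (auto simp: limitin_metric_dist_null)
  then show ?thesis
    using that[of l] x by (simp add: norm_dist_def)
qed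

lemma eval_limit:
  assumes "\<And>n. x n \<in> H" "l \<in> H" "(\<lambda>n. nrm (x n - l)) \<longlonglongrightarrow> 0"
  shows "(\<lambda>n. x n p) \<longlonglongrightarrow> l p"
proof -
  obtain C where C: "\<And>f. f \<in> H \<Longrightarrow> cmod (f p) \<le> C * nrm f"
    using evaluation_bounded by blast
  have "(\<lambda>n. x n p - l p) \<longlonglongrightarrow> 0"
  proof (rule Lim_null_comparison)
    show "\<forall>\<^sub>F n in sequentially. norm (x n p - l p) \<le> C * nrm (x n - l)"
      using C[OF diff_mem] assms by (intro always_eventually) simp
    show "(\<lambda>n. C * nrm (x n - l)) \<longlonglongrightarrow> 0"
      using tendsto_mult_right_zero assms(3) by blast
  qed
  then show ?thesis by (rule LIM_zero_cancel)
qed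

end

section \<open>Functions dominated by the kernel\<close>

locale kernel_space = hilbert_function_space H ip
  for H :: "('x \<Rightarrow> complex) set" and ip +
  fixes k :: "'x \<Rightarrow> 'x \<Rightarrow> complex"
  assumes kernel: "reproducing_kernel H ip k"
begin

text \<open>These finite kernel sums act as test functions: pairing with one is a finite weighted
  sum of values, which makes sense even for a function not yet known to lie in
  \<open>H\<close>.\<close>

definition kc :: "'x set \<Rightarrow> ('x \<Rightarrow> complex) \<Rightarrow> 'x \<Rightarrow> complex" where
  "kc Y a = (\<lambda>z. \<Sum>w\<in>Y. a w * k z w)"

lemma kernel_mem: "(\<lambda>z. k z w) \<in> H"
  using kernel by (simp add: reproducing_kernel_def)

lemma ip_kernel: "f \<in> H \<Longrightarrow> ip f (\<lambda>z. k z w) = f w"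
  using kernel by (simp add: reproducing_kernel_def)

lemma kc_mem: "kc Y a \<in> H"
  unfolding kc_def by (intro lincomb_mem kernel_mem)

lemma ip_kc: "f \<in> H \<Longrightarrow> ip f (kc Y a) = (\<Sum>w\<in>Y. cnj (a w) * f w)"
  unfolding kc_def by (subst ip_lincomb_right) (auto simp: kernel_mem ip_kernel)

lemma kernel_commute: "k w z = cnj (k z w)"
  using ip_commute[OF kernel_mem kernel_mem, of z w] by (simp add: ip_kernel kernel_mem)

lemma ip_kc_kc: "ip (kc Y a) (kc Y a) = (\<Sum>z\<in>Y. \<Sum>w\<in>Y. cnj (a z) * a w * k z w)"
  by (simp add: ip_kc kc_mem) (simp add: kc_def sum_distrib_left mult.assoc)

lemma sum_union_comb:
  fixes a b \<phi> :: "'x \<Rightarrow> complex"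
  assumes "finite Y" "finite Z"
  shows "(\<Sum>w\<in>Y \<union> Z. (s * (if w \<in> Y then a w else 0) + t * (if w \<in> Z then b w else 0)) * \<phi> w)
    = s * (\<Sum>w\<in>Y. a w * \<phi> w) + t * (\<Sum>w\<in>Z. b w * \<phi> w)"
proof -
  have "(\<Sum>w\<in>Y. a w * \<phi> w) = (\<Sum>w\<in>Y \<union> Z. (if w \<in> Y then a w else 0) * \<phi> w)"
    using assms by (intro sum.mono_neutral_cong_left) auto
  moreover have "(\<Sum>w\<in>Z. b w * \<phi> w) = (\<Sum>w\<in>Y \<union> Z. (if w \<in> Z then b w else 0) * \<phi> w)"
    using assms by (intro sum.mono_neutral_cong_left) auto
  ultimately show ?thesis
    by (simp add: sum_distrib_left sum.distrib algebra_simps)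
qed

text \<open>The second clause ranges over arbitrary functions \<open>f\<close> and concerns the
  coefficients themselves, since linearly dependent kernel functions do not determine them.\<close>

lemma kc_comb:
  assumes "finite Y" "finite Z"
  obtains c where
    "kc (Y \<union> Z) c = (\<lambda>z. s * kc Y a z) + (\<lambda>z. t * kc Z b z)"
    "\<And>f. (\<Sum>w\<in>Y \<union> Z. cnj (c w) * f w)
       = cnj s * (\<Sum>w\<in>Y. cnj (a w) * f w) + cnj t * (\<Sum>w\<in>Z. cnj (b w) * f w)"
proof
  let ?c = "\<lambda>w. s * (if w \<in> Y then a w else 0) + t * (if w \<in> Z then b w else 0)"
  show "kc (Y \<union> Z) ?c = (\<lambda>z. s * kc Y a z) + (\<lambda>z. t * kc Z b z)"
    unfolding kc_def by (simp add: sum_union_comb[OF assms] fun_eq_iff)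
  fix f
  have "(\<Sum>w\<in>Y \<union> Z. cnj (?c w) * f w) = (\<Sum>w\<in>Y \<union> Z. (cnj s * (if w \<in> Y then cnj (a w) else 0)
      + cnj t * (if w \<in> Z then cnj (b w) else 0)) * f w)"
    by (intro sum.cong) auto
  then show "(\<Sum>w\<in>Y \<union> Z. cnj (?c w) * f w)
       = cnj s * (\<Sum>w\<in>Y. cnj (a w) * f w) + cnj t * (\<Sum>w\<in>Z. cnj (b w) * f w)"
    by (simp only: sum_union_comb[OF assms])
qed

text \<open>A Riesz representation argument done by hand: the hypothesis bounds the functional
  \<open>J\<close> from below, a minimizing sequence of kernel sums converges by the parallelogram
  law, and the variational equation at the minimum says that the limit takes the values of
  \<open>f\<close>.\<close>

lemma kernel_criterion_aux:
  assumes bound: "\<And>Y a. finite Y \<Longrightarrow> 2 * Re (\<Sum>w\<in>Y. cnj (a w) * f w) \<le> C + (nrm (kc Y a))\<^sup>2"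
  obtains Y a where "f \<in> H" "\<And>n. finite (Y n)" "(\<lambda>n::nat. nrm (kc (Y n) (a n) - f)) \<longlonglongrightarrow> 0"
proof -
  define L where "L Y a = (\<Sum>w\<in>Y. cnj (a w) * f w)" for Y a
  define J where "J Y a = (nrm (kc Y a))\<^sup>2 - 2 * Re (L Y a)" for Y a
  define m where "m = Inf {J Y a | Y a. finite Y}"
  have bdd: "bdd_below {J Y a | Y a. finite Y}"
  proof (rule bdd_belowI)
    fix x assume "x \<in> {J Y a | Y a. finite Y}"
    then obtain Y a where "x = J Y a" "finite Y" by blast
    then show "- C \<le> x" using bound[of Y a] by (simp add: J_def L_def)
  qed
  have m_le: "m \<le> J Y a" if "finite Y" for Y a
    unfolding m_def using that bdd by (intro cInf_lower) auto
  define r where "r n = inverse (real (Suc n))" for n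
  have "\<exists>Y a. finite Y \<and> J Y a < m + r n" for n
  proof -
    have "Inf {J Y a | Y a. finite Y} < m + r n"
      by (simp add: m_def r_def)
    from cInf_lessD[OF _ this] show ?thesis by blast
  qed
  then obtain Y a where fin: "\<And>n. finite (Y n)"
    and small: "\<And>n. J (Y n) (a n) < m + r n"
    by metis
  define x where "x n = kc (Y n) (a n)" for n
  have x_mem: "x n \<in> H" for n by (simp add: x_def kc_mem)
  \<comment> \<open>The parallelogram law: the midpoint of two kernel sums is a kernel sum, so its
    \<open>J\<close> is at least \<open>m\<close>, and the additive part \<open>L\<close>
    cancels.\<close>
  have close: "(nrm (x i - x j))\<^sup>2 \<le> 2 * (J (Y i) (a i) - m) + 2 * (J (Y j) (a j) - m)" for i j
  proof -
    obtain c where c: "kc (Y i \<union> Y j) c = (\<lambda>z. 1/2 * kc (Y i) (a i) z) + (\<lambda>z. 1/2 * kc (Y j) (a j) z)"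
      "\<And>f. (\<Sum>w\<in>Y i \<union> Y j. cnj (c w) * f w)
       = cnj (1/2) * (\<Sum>w\<in>Y i. cnj (a i w) * f w) + cnj (1/2) * (\<Sum>w\<in>Y j. cnj (a j w) * f w)"
      by (rule kc_comb[OF fin[of i] fin[of j], where s = "1/2" and t = "1/2" and a = "a i" and b = "a j"]) blast
    have mid: "kc (Y i \<union> Y j) c = (\<lambda>z. 1/2 * (x i + x j) z)"
      unfolding c(1) x_def by (simp add: fun_eq_iff)
    have "nrm (kc (Y i \<union> Y j) c) = 1/2 * nrm (x i + x j)"
      unfolding mid by (subst nrm_scale) (simp_all add: add_mem x_mem)
    then have "4 * (nrm (kc (Y i \<union> Y j) c))\<^sup>2 = (nrm (x i + x j))\<^sup>2"
      by (simp only: power_mult_distrib) (simp add: power2_eq_square)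
    moreover have "L (Y i \<union> Y j) c + L (Y i \<union> Y j) c = L (Y i) (a i) + L (Y j) (a j)"
      unfolding L_def c(2) by simp
    from arg_cong[OF this, of Re]
    have "2 * Re (L (Y i \<union> Y j) c) = Re (L (Y i) (a i)) + Re (L (Y j) (a j))"
      by simp
    ultimately have "4 * J (Y i \<union> Y j) c = (nrm (x i + x j))\<^sup>2 - 4 * (Re (L (Y i) (a i)) + Re (L (Y j) (a j)))"
      by (simp add: J_def)
    moreover have "m \<le> J (Y i \<union> Y j) c" using fin by (intro m_le) simp
    ultimately show ?thesis
      using nrm_add_sq[OF x_mem x_mem, of i j] nrm_diff_sq[OF x_mem x_mem, of i j]
      by (simp add: J_def x_def)
  qed
  have "\<exists>N. \<forall>i\<ge>N. \<forall>j\<ge>N. nrm (x i - x j) < e" if "e > 0" for e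
  proof -
    \<comment> \<open>By \<open>close\<close> the squared distance is at most four times
      \<open>r N\<close> beyond \<open>N\<close>.\<close>
    obtain N where N: "r N < e\<^sup>2 / 4"
    proof -
      have "0 < e\<^sup>2 / 4" using \<open>e > 0\<close> by simp
      from reals_Archimedean[OF this, folded r_def] show ?thesis using that by blast
    qed
    have "nrm (x i - x j) < e" if "N \<le> i" "N \<le> j" for i j
    proof (rule power2_less_imp_less)
      have "r i \<le> r N" "r j \<le> r N"
        using that by (auto simp: r_def intro!: le_imp_inverse_le)
      then show "(nrm (x i - x j))\<^sup>2 < e\<^sup>2"
        using close[of i j] small[of i] small[of j] N
        by argo
    qed (use \<open>e > 0\<close> in simp)
    then show ?thesis by blast
  qed
  then obtain l where l: "l \<in> H" "(\<lambda>n. nrm (x n - l)) \<longlonglongrightarrow> 0"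
    using Cauchy_limit[of x] x_mem by metis
  have J_lim: "(\<lambda>n. J (Y n) (a n)) \<longlonglongrightarrow> m"
  proof (rule tendsto_sandwich[of "\<lambda>_. m" _ _ "\<lambda>n. m + r n"])
    show "(\<lambda>n. m + r n) \<longlonglongrightarrow> m"
      using tendsto_add[OF tendsto_const LIMSEQ_inverse_real_of_nat, of m] by (simp add: r_def)
  qed (use m_le fin small in \<open>auto intro!: always_eventually less_imp_le\<close>)
  have "l p = f p" for p
  proof -
    define K where "K = (nrm (\<lambda>z. k z p))\<^sup>2"
    \<comment> \<open>Adding \<open>t\<close> times the kernel function at \<open>p\<close> to the
      minimizing sequence cannot push \<open>J\<close> below \<open>m\<close>; the inequality passes
      to the limit.\<close>
    have variation: "0 \<le> (cmod t)\<^sup>2 * K + 2 * Re (cnj t * (l p - f p))" for t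
    proof -
      have "0 \<le> (J (Y n) (a n) - m) + (cmod t)\<^sup>2 * K + 2 * Re (cnj t * (x n p - f p))" for n
      proof -
        obtain c where c: "kc (Y n \<union> {p}) c = (\<lambda>z. 1 * kc (Y n) (a n) z) + (\<lambda>z. t * kc {p} (\<lambda>_. 1) z)"
          "\<And>f. (\<Sum>w\<in>Y n \<union> {p}. cnj (c w) * f w)
           = cnj 1 * (\<Sum>w\<in>Y n. cnj (a n w) * f w) + cnj t * (\<Sum>w\<in>{p}. cnj 1 * f w)"
          by (rule kc_comb[OF fin[of n], where Z = "{p}" and s = 1 and t = t and a = "a n" and b = "\<lambda>_. 1"]) (simp, blast)
        have "kc (Y n \<union> {p}) c = x n + (\<lambda>z. t * k z p)"
          unfolding c(1) x_def by (simp add: kc_def)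
        then have "(nrm (kc (Y n \<union> {p}) c))\<^sup>2 = (nrm (x n))\<^sup>2 + (cmod t)\<^sup>2 * K + 2 * Re (cnj t * x n p)"
          using nrm_add_sq[OF x_mem scale_mem[OF kernel_mem], of n t p]
          by (simp add: nrm_scale kernel_mem ip_scale_right x_mem ip_kernel K_def power_mult_distrib)
        moreover have "L (Y n \<union> {p}) c = L (Y n) (a n) + cnj t * f p"
          unfolding L_def c(2) by simp
        moreover have "m \<le> J (Y n \<union> {p}) c" using fin by (intro m_le) simp
        ultimately show ?thesis
          by (simp add: J_def x_def algebra_simps)
      qed
      moreover have "(\<lambda>n. (J (Y n) (a n) - m) + (cmod t)\<^sup>2 * K + 2 * Re (cnj t * (x n p - f p)))
          \<longlonglongrightarrow> (m - m) + (cmod t)\<^sup>2 * K + 2 * Re (cnj t * (l p - f p))"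
        by (intro tendsto_intros J_lim eval_limit[OF x_mem l])
      ultimately have "0 \<le> (m - m) + (cmod t)\<^sup>2 * K + 2 * Re (cnj t * (l p - f p))"
        by (intro LIMSEQ_le_const) auto
      then show ?thesis by simp
    qed
    define d where "d = l p - f p"
    \<comment> \<open>With \<open>t = - s d\<close> the linear term is of order \<open>s\<close> and
      the quadratic one of order \<open>s\<close> squared; the choice of \<open>s\<close> makes the
      linear one win, also when \<open>K = 0\<close>.\<close>
    define s where "s = 1 / (K + 1)"
    have K: "0 \<le> K" by (simp add: K_def)
    have "0 \<le> (cmod (- (of_real s * d)))\<^sup>2 * K + 2 * Re (cnj (- (of_real s * d)) * d)"
      using variation[of "- (of_real s * d)"] by (simp add: d_def)
    moreover have "Re (cnj (- (of_real s * d)) * d) = - s * (cmod d)\<^sup>2"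
      by (simp add: cmod_power2) (simp add: power2_eq_square algebra_simps)
    moreover have "(cmod (- (of_real s * d)))\<^sup>2 = s\<^sup>2 * (cmod d)\<^sup>2"
      by (simp add: norm_mult power_mult_distrib)
    ultimately have "0 \<le> s * (cmod d)\<^sup>2 * (s * K - 2)"
      by (simp add: algebra_simps power2_eq_square)
    moreover have "0 < s" "s * K - 2 < 0" using K by (auto simp: s_def field_simps)
    ultimately have "(cmod d)\<^sup>2 \<le> 0"
      by (meson mult_pos_neg mult_pos_pos not_le)
    then show ?thesis by (simp add: d_def)
  qed
  then have "l = f" by auto
  with l fin show ?thesis
    using that[of Y a] by (simp add: x_def)
qed

text \<open>The squared distance from \<open>f\<close> to any kernel sum is nonnegative, which is
  the criterion with \<open>C\<close> the squared norm of \<open>f\<close>; the criterion then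
  delivers approximating sums.\<close>

lemma kernel_dense:
  assumes f: "f \<in> H"
  obtains Y a where "\<And>n. finite (Y n)" "(\<lambda>n::nat. nrm (kc (Y n) (a n) - f)) \<longlonglongrightarrow> 0"
proof -
  have "2 * Re (\<Sum>w\<in>Y. cnj (a w) * f w) \<le> (nrm f)\<^sup>2 + (nrm (kc Y a))\<^sup>2" for Y a
    using nrm_diff_sq[OF f kc_mem, of Y a] zero_le_power2[of "nrm (f - kc Y a)"]
    unfolding ip_kc[OF f, symmetric] by linarith
  from kernel_criterion_aux[of f, OF this] show ?thesis
    using that by blast
qed

text \<open>The membership test behind all later duality arguments. For the norm, the bound is
  evaluated at kernel sums that converge to \<open>f\<close>.\<close>

lemma kernel_criterion:
  assumes bound: "\<And>Y a. finite Y \<Longrightarrow> 2 * Re (\<Sum>w\<in>Y. cnj (a w) * f w) \<le> C + (nrm (kc Y a))\<^sup>2"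
  shows "f \<in> H" "(nrm f)\<^sup>2 \<le> C"
proof -
  obtain Y a where f: "f \<in> H" and fin: "\<And>n. finite (Y n)"
    and lim: "(\<lambda>n::nat. nrm (kc (Y n) (a n) - f)) \<longlonglongrightarrow> 0"
    using kernel_criterion_aux[of f, OF bound] by blast
  show "f \<in> H" by (rule f)
  have "(nrm f)\<^sup>2 \<le> C + (nrm (kc (Y n) (a n) - f))\<^sup>2" for n
    using bound[OF fin[of n], of "a n"] nrm_diff_sq[OF kc_mem f, of "Y n" "a n"] Re_ip_commute[OF f kc_mem, of "Y n" "a n"]
    by (simp add: ip_kc[OF f, symmetric])
  moreover have "(\<lambda>n. C + (nrm (kc (Y n) (a n) - f))\<^sup>2) \<longlonglongrightarrow> C + 0\<^sup>2"
    by (intro tendsto_intros lim)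
  ultimately have "(nrm f)\<^sup>2 \<le> C + 0\<^sup>2"
    by (intro LIMSEQ_le_const) auto
  then show "(nrm f)\<^sup>2 \<le> C" by simp
qed

end

section \<open>Schur products and the row contraction\<close>

context hilbert_function_space
begin

text \<open>One Gram-Schmidt step per vector: the projections onto the normalized \<open>x p\<close>
  are split off, and the induction hypothesis factors the Gram matrix of the remainders.\<close>

lemma gram_factorization:
  assumes "finite I" "\<And>i. i \<in> I \<Longrightarrow> x i \<in> H"
  shows "\<exists>(n::nat) c. \<forall>i\<in>I. \<forall>j\<in>I. ip (x i) (x j) = (\<Sum>l<n. c l i * cnj (c l j))"
  using assms
proof (induction I arbitrary: x rule: finite_induct)
  case (insert p I)
  \<comment> \<open>If \<open>x p = 0\<close>, then \<open>e = 0\<close>, because \<open>inverse 0 = 0\<close>.\<close>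
  define e where "e = (\<lambda>z. of_real (inverse (nrm (x p))) * x p z)"
  define x' where "x' i = x i - (\<lambda>z. ip (x i) e * e z)" for i
  have xp: "x p \<in> H" using insert.prems by simp
  have e: "e \<in> H" unfolding e_def by (rule scale_mem[OF xp])
  have x': "x' i \<in> H" if "i \<in> insert p I" for i
    unfolding x'_def using that by (intro diff_mem scale_mem e insert.prems)
  \<comment> \<open>This form covers both cases at once: either \<open>e\<close> is a unit vector,
    or \<open>e = 0\<close> and then \<open>c = 0\<close> too.\<close>
  have ee: "c * ip e e = c" if "c = ip y e" "y \<in> H" for c y
  proof (cases "nrm (x p) = 0")
    case True
    then have "e = 0" by (auto simp: e_def fun_eq_iff)
    then show ?thesis using that by (simp add: ip_zero_right)
  next
    case False
    have "ip e e = of_real (inverse (nrm (x p))) * (of_real (inverse (nrm (x p))) * ip (x p) (x p))"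
      unfolding e_def using xp by (simp add: ip_scale_left ip_scale_right scale_mem)
    also have "\<dots> = 1" using False by (simp add: ip_self[OF xp] power2_eq_square field_simps)
    finally show ?thesis by simp
  qed
  have "x' p = 0"
  proof (cases "nrm (x p) = 0")
    case True
    then have "e = 0" "x p = 0" using xp nrm_eq_0 by (auto simp: e_def fun_eq_iff)
    then show ?thesis by (simp add: x'_def fun_eq_iff)
  next
    case False
    have "ip (x p) e = of_real (nrm (x p))"
      unfolding e_def using False by (simp add: ip_scale_right xp ip_self power2_eq_square)
    then show ?thesis using False by (simp add: x'_def fun_eq_iff e_def)
  qed
  have decomp: "ip (x i) (x j) = ip (x' i) (x' j) + ip (x i) e * cnj (ip (x j) e)"
    if "i \<in> insert p I" "j \<in> insert p I" for i j
  proof -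
    have m: "x i \<in> H" "x j \<in> H" using that insert.prems by auto
    define \<alpha> \<beta> where "\<alpha> = ip (x i) e" and "\<beta> = ip (x j) e"
    have "ip (x i - (\<lambda>z. \<alpha> * e z)) (x j - (\<lambda>z. \<beta> * e z))
        = ip (x i) (x j) - cnj \<beta> * ip (x i) e - (\<alpha> * ip e (x j) - cnj \<beta> * (\<alpha> * ip e e))"
      using m e by (simp add: ip_diff_left ip_diff_right ip_scale_left ip_scale_right scale_mem diff_mem
          right_diff_distrib)
    moreover have "\<alpha> * ip e e = \<alpha>" using ee[OF _ m(1)] by (simp add: \<alpha>_def)
    moreover have "ip e (x j) = cnj \<beta>" unfolding \<beta>_def by (rule ip_commute[OF m(2) e])
    ultimately show ?thesis
      by (simp add: x'_def \<alpha>_def[symmetric] \<beta>_def[symmetric])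
  qed
  obtain n :: nat and c where c: "\<And>i j. \<lbrakk>i \<in> I; j \<in> I\<rbrakk> \<Longrightarrow> ip (x' i) (x' j) = (\<Sum>l<n. c l i * cnj (c l j))"
    using insert.IH[of x'] x' by (meson insertI2)
  \<comment> \<open>The new row, with index \<open>n\<close>, holds the projection coefficients; the
    earlier rows vanish at \<open>p\<close> because \<open>x' p = 0\<close>.\<close>
  define c' where "c' l i = (if l < n then (if i = p then 0 else c l i) else ip (x i) e)" for l i
  have "ip (x i) (x j) = (\<Sum>l<Suc n. c' l i * cnj (c' l j))"
    if ij: "i \<in> insert p I" "j \<in> insert p I" for i j
  proof -
    have "ip (x' i) (x' j) = (\<Sum>l<n. c' l i * cnj (c' l j))"
    proof (cases "i = p \<or> j = p")
      case True
      then show ?thesis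
        using \<open>x' p = 0\<close> x' ij by (auto simp: c'_def ip_zero_left ip_zero_right zero_mem)
    next
      case False
      then show ?thesis using ij by (auto simp: c c'_def intro!: sum.cong)
    qed
    then show ?thesis unfolding decomp[OF ij] by (simp add: c'_def)
  qed
  then show ?case by blast
qed auto

text \<open>Writing the Gram matrix as a sum of rank-one matrices turns the double sum into a sum of
  values of the quadratic form of \<open>A\<close>, one for each vector \<open>c l\<close>.\<close>

lemma Schur_product:
  assumes fin: "finite I" and x: "\<And>i. i \<in> I \<Longrightarrow> x i \<in> H"
    and psd: "\<And>a :: 'i \<Rightarrow> complex. 0 \<le> Re (\<Sum>i\<in>I. \<Sum>j\<in>I. cnj (a i) * a j * A i j)"
  shows "0 \<le> Re (\<Sum>i\<in>I. \<Sum>j\<in>I. A i j * ip (x j) (x i))"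
proof -
  obtain n :: nat and c where c: "\<And>i j. \<lbrakk>i \<in> I; j \<in> I\<rbrakk> \<Longrightarrow> ip (x i) (x j) = (\<Sum>l<n. c l i * cnj (c l j))"
    using gram_factorization[of I x] fin x by meson
  have "(\<Sum>i\<in>I. \<Sum>j\<in>I. A i j * ip (x j) (x i)) = (\<Sum>i\<in>I. \<Sum>j\<in>I. \<Sum>l<n. cnj (c l i) * c l j * A i j)"
    by (intro sum.cong refl) (simp add: c sum_distrib_left mult_ac)
  also have "\<dots> = (\<Sum>i\<in>I. \<Sum>l<n. \<Sum>j\<in>I. cnj (c l i) * c l j * A i j)"
    by (intro sum.cong refl sum.swap)
  also have "\<dots> = (\<Sum>l<n. \<Sum>i\<in>I. \<Sum>j\<in>I. cnj (c l i) * c l j * A i j)"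
    by (rule sum.swap)
  finally have eq: "Re (\<Sum>i\<in>I. \<Sum>j\<in>I. A i j * ip (x j) (x i))
      = (\<Sum>l<n. Re (\<Sum>i\<in>I. \<Sum>j\<in>I. cnj (c l i) * c l j * A i j))"
    by simp
  show ?thesis unfolding eq by (intro sum_nonneg psd)
qed

end

lemma sum_sum_restrict:
  assumes "finite I" "Z \<subseteq> I" "Y \<subseteq> I"
    and "\<And>z w. z \<in> I - Z \<Longrightarrow> F z w = 0" "\<And>z w. w \<in> I - Y \<Longrightarrow> F z w = 0"
  shows "(\<Sum>z\<in>I. \<Sum>w\<in>I. F z w) = (\<Sum>z\<in>Z. \<Sum>w\<in>Y. F z w)"
proof -
  have "(\<Sum>z\<in>I. \<Sum>w\<in>I. F z w) = (\<Sum>z\<in>Z. \<Sum>w\<in>I. F z w)"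
    using assms by (intro sum.mono_neutral_right) auto
  also have "\<dots> = (\<Sum>z\<in>Z. \<Sum>w\<in>Y. F z w)"
    using assms by (intro sum.cong refl sum.mono_neutral_right) auto
  finally show ?thesis .
qed

context kernel_space
begin

text \<open>The inequality of the membership criterion involves only finitely many values of the
  function, so with \<open>C\<close> equal to \<open>R\<close> squared it survives pointwise
  limits.\<close>

lemma bounded_pointwise_limit:
  assumes x: "\<And>n::nat. x n \<in> H" "\<And>n. nrm (x n) \<le> R" and lim: "\<And>p. (\<lambda>n. x n p) \<longlonglongrightarrow> f p"
  shows "f \<in> H" "nrm f \<le> R"
proof -
  have "0 \<le> R" using x nrm_nonneg order_trans by blast
  have bound: "2 * Re (\<Sum>w\<in>Y. cnj (a w) * f w) \<le> R\<^sup>2 + (nrm (kc Y a))\<^sup>2" if "finite Y" for Y a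
  proof (rule LIMSEQ_le_const2)
    show "(\<lambda>n. 2 * Re (\<Sum>w\<in>Y. cnj (a w) * x n w)) \<longlonglongrightarrow> 2 * Re (\<Sum>w\<in>Y. cnj (a w) * f w)"
      by (intro tendsto_intros lim)
    have "2 * Re (\<Sum>w\<in>Y. cnj (a w) * x n w) \<le> R\<^sup>2 + (nrm (kc Y a))\<^sup>2" for n
      using nrm_diff_sq[OF x(1) kc_mem, of n Y a] zero_le_power2[of "nrm (x n - kc Y a)"]
        power_mono[OF x(2)[of n] nrm_nonneg[OF x(1)], of 2]
      unfolding ip_kc[OF x(1), symmetric] by linarith
    then show "\<exists>N. \<forall>n\<ge>N. 2 * Re (\<Sum>w\<in>Y. cnj (a w) * x n w) \<le> R\<^sup>2 + (nrm (kc Y a))\<^sup>2"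
      by blast
  qed
  show "f \<in> H" by (rule kernel_criterion(1)[OF bound])
  show "nrm f \<le> R"
    using kernel_criterion(2)[OF bound] \<open>0 \<le> R\<close> by (rule power2_le_imp_le)
qed

end

section \<open>Complete Pick kernels and their row of multipliers\<close>

locale pick_space = kernel_space H ip k
  for H :: "('x \<Rightarrow> complex) set" and ip k +
  fixes u :: "'x \<Rightarrow> 'x \<Rightarrow> complex"
  assumes u_pd: "positive_definite u" and u_ne_1: "u z w \<noteq> 1"
    and k_eq: "k z w = 1 / (1 - u z w)"
begin

lemma k_ne_0: "k z w \<noteq> 0"
  using u_ne_1[of z w] by (simp add: k_eq)

lemma u_k: "u z w * k z w = k z w - 1"
  using u_ne_1[of z w] by (simp add: k_eq field_simps)

lemma u_commute: "u w z = cnj (u z w)"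
proof -
  have "u z w = 1 - 1 / k z w" for z w by (simp add: k_eq)
  then show ?thesis using kernel_commute[of w z] by simp
qed

lemma u_psd:
  assumes "finite Y"
  shows "(\<Sum>z\<in>Y. \<Sum>w\<in>Y. cnj (a z) * a w * u z w) \<in> \<real>\<^sub>\<ge>\<^sub>0"
proof -
  obtain e where e: "bij_betw e {0..<card Y} Y"
    using ex_bij_betw_nat_finite[OF assms] by blast
  have reindex: "(\<Sum>z\<in>Y. F z) = (\<Sum>i<card Y. F (e i))" for F :: "'x \<Rightarrow> complex"
    using sum.reindex_bij_betw[OF e, of F] by (simp add: atLeast0LessThan)
  have "(\<Sum>i<card Y. \<Sum>j<card Y. cnj (a (e i)) * a (e j) * u (e i) (e j)) \<in> \<real>\<^sub>\<ge>\<^sub>0"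
    \<comment> \<open>The coefficients are conjugated because \<open>positive_definite\<close>
      conjugates the second factor, whereas the form here conjugates the first.\<close>
    using u_pd[unfolded positive_definite_def, THEN spec[of _ "card Y"], THEN spec[of _ e],
        THEN spec[of _ "\<lambda>i. cnj (a (e i))"]] by simp
  then show ?thesis by (simp add: reindex)
qed

text \<open>By duality against a test sum \<open>kc P c\<close>: the Schur product theorem for
  \<open>u\<close> and the vectors \<open>x w - c w * k\<^sub>w\<close> gives a nonnegative
  quantity. Its cross terms contain the pairing with \<open>f\<close>, and its pure kernel term is
  at most the squared norm of \<open>kc P c\<close>.\<close>

lemma row_contraction:
  assumes fin: "finite Y" and x: "\<And>w. x w \<in> H"
  shows "(\<lambda>p. \<Sum>w\<in>Y. u p w * x w p) \<in> H"
    and "(nrm (\<lambda>p. \<Sum>w\<in>Y. u p w * x w p))\<^sup>2 \<le> Re (\<Sum>z\<in>Y. \<Sum>w\<in>Y. u z w * ip (x w) (x z))"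
proof -
  define f where "f = (\<lambda>p. \<Sum>w\<in>Y. u p w * x w p)"
  define C where "C = Re (\<Sum>z\<in>Y. \<Sum>w\<in>Y. u z w * ip (x w) (x z))"
  have bound: "2 * Re (\<Sum>w\<in>P. cnj (c w) * f w) \<le> C + (nrm (kc P c))\<^sup>2" if P: "finite P" for P c
  proof -
    \<comment> \<open>The two families are extended by zero to a common index set, so that their
      difference can be formed.\<close>
    define I where "I = Y \<union> P"
    define x' where "x' w = (if w \<in> Y then x w else 0)" for w
    define y where "y w = (if w \<in> P then (\<lambda>z. c w * k z w) else 0)" for w
    have I: "finite I" "Y \<subseteq> I" "P \<subseteq> I" using fin P by (auto simp: I_def)
    have mem: "x' w \<in> H" "y w \<in> H" for w
      by (auto simp: x'_def y_def x zero_mem intro: scale_mem kernel_mem)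
    have "0 \<le> Re (\<Sum>z\<in>I. \<Sum>w\<in>I. u z w * ip (x' w - y w) (x' z - y z))"
      using u_psd[OF I(1)] by (intro Schur_product I diff_mem mem) (auto simp: complex_nonneg_Reals_iff)
    also have "(\<Sum>z\<in>I. \<Sum>w\<in>I. u z w * ip (x' w - y w) (x' z - y z)) =
        (\<Sum>z\<in>I. \<Sum>w\<in>I. u z w * ip (x' w) (x' z)) - (\<Sum>z\<in>I. \<Sum>w\<in>I. u z w * ip (x' w) (y z))
        - (\<Sum>z\<in>I. \<Sum>w\<in>I. u z w * ip (y w) (x' z)) + (\<Sum>z\<in>I. \<Sum>w\<in>I. u z w * ip (y w) (y z))"
      by (simp add: ip_diff_left ip_diff_right mem diff_mem algebra_simps sum.distrib sum_subtractf)
    also have "(\<Sum>z\<in>I. \<Sum>w\<in>I. u z w * ip (x' w) (x' z)) = (\<Sum>z\<in>Y. \<Sum>w\<in>Y. u z w * ip (x w) (x z))"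
      by (subst sum_sum_restrict[OF I(1) I(2) I(2)])
        (auto simp: x'_def ip_zero_left ip_zero_right x zero_mem)
    also have "(\<Sum>z\<in>I. \<Sum>w\<in>I. u z w * ip (y w) (y z)) = (\<Sum>z\<in>P. \<Sum>w\<in>P. u z w * ip (y w) (y z))"
      using mem by (intro sum_sum_restrict[OF I(1) I(3) I(3)])
        (auto simp: y_def ip_zero_left ip_zero_right zero_mem)
    \<comment> \<open>Here \<open>u k = k - 1\<close> enters; the constant 1 contributes minus the
      squared modulus of \<open>sum c P\<close>, which has the favourable sign.\<close>
    also have "\<dots> = (\<Sum>z\<in>P. \<Sum>w\<in>P. cnj (c z) * c w * k z w - cnj (c z) * c w)"
    proof (intro sum.cong refl)
      fix z w assume "z \<in> P" "w \<in> P"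
      then have eq: "u z w * ip (y w) (y z) = cnj (c z) * c w * (u z w * k z w)"
        by (simp add: y_def ip_scale_left ip_scale_right scale_mem kernel_mem ip_kernel)
      show "u z w * ip (y w) (y z) = cnj (c z) * c w * k z w - cnj (c z) * c w"
        unfolding eq u_k by (simp add: algebra_simps)
    qed
    also have "\<dots> = ip (kc P c) (kc P c) - cnj (sum c P) * sum c P"
      by (simp add: ip_kc_kc sum_subtractf sum_product)
    finally have "0 \<le> C - Re (\<Sum>z\<in>I. \<Sum>w\<in>I. u z w * ip (x' w) (y z))
        - Re (\<Sum>z\<in>I. \<Sum>w\<in>I. u z w * ip (y w) (x' z))
        + ((nrm (kc P c))\<^sup>2 - Re (cnj (sum c P) * sum c P))"
      by (simp only: C_def nrm_sq[OF kc_mem] minus_complex.sel plus_complex.sel)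
    moreover have "0 \<le> Re (cnj s * s)" for s :: complex by simp
    from this[of "sum c P"] have "0 \<le> Re (cnj (sum c P) * sum c P)" .
    \<comment> \<open>The two cross terms are complex conjugates of each other, as \<open>u\<close>
      is Hermitian.\<close>
    moreover have "Re (\<Sum>z\<in>I. \<Sum>w\<in>I. u z w * ip (y w) (x' z)) = Re (\<Sum>z\<in>I. \<Sum>w\<in>I. u z w * ip (x' w) (y z))"
    proof -
      have "(\<Sum>z\<in>I. \<Sum>w\<in>I. u z w * ip (y w) (x' z)) = (\<Sum>w\<in>I. \<Sum>z\<in>I. u z w * ip (y w) (x' z))"
        by (rule sum.swap)
      also have "\<dots> = cnj (\<Sum>w\<in>I. \<Sum>z\<in>I. u w z * ip (x' z) (y w))"
        unfolding cnj_sum by (intro sum.cong refl) (metis complex_cnj_mult u_commute ip_commute mem)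
      finally show ?thesis by simp
    qed
    moreover have "(\<Sum>z\<in>I. \<Sum>w\<in>I. u z w * ip (x' w) (y z)) = (\<Sum>z\<in>P. cnj (c z) * f z)"
    proof -
      have "(\<Sum>z\<in>I. \<Sum>w\<in>I. u z w * ip (x' w) (y z)) = (\<Sum>z\<in>P. \<Sum>w\<in>Y. u z w * ip (x' w) (y z))"
        using mem by (intro sum_sum_restrict I) (auto simp: x'_def y_def ip_zero_left ip_zero_right)
      also have "\<dots> = (\<Sum>z\<in>P. cnj (c z) * f z)"
        by (intro sum.cong refl) (simp add: x'_def y_def f_def ip_scale_right kernel_mem x ip_kernel
            sum_distrib_left mult_ac)
      finally show ?thesis .
    qed
    ultimately show ?thesis by simp
  qed
  show "(\<lambda>p. \<Sum>w\<in>Y. u p w * x w p) \<in> H"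
    using kernel_criterion(1)[of f, OF bound] by (simp add: f_def)
  show "(nrm (\<lambda>p. \<Sum>w\<in>Y. u p w * x w p))\<^sup>2 \<le> Re (\<Sum>z\<in>Y. \<Sum>w\<in>Y. u z w * ip (x w) (x z))"
    using kernel_criterion(2)[of f, OF bound] by (simp add: f_def C_def)
qed

end

section \<open>The key inequality\<close>

context pick_space
begin

text \<open>A bound for the norm of multiplication by \<open>u\<^sub>w\<close>, and thus the ratio
  of the geometric series that represents multiplication by \<open>k\<^sub>w\<close>.\<close>

definition q :: "'x \<Rightarrow> real" where
  "q w = sqrt (Re (u w w))"

text \<open>The value \<open>k w w\<close> is the squared norm of \<open>k\<^sub>w\<close>, hence
  nonnegative, and \<open>u w w\<close> differs from 1; so \<open>1 - u w w\<close> must be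
  positive.\<close>

lemma Re_u_diag: "0 \<le> Re (u w w)" "Re (u w w) < 1"
proof -
  have u: "u w w \<in> \<real>\<^sub>\<ge>\<^sub>0" using u_psd[of "{w}" "\<lambda>_. 1"] by simp
  then show "0 \<le> Re (u w w)" by (simp add: complex_nonneg_Reals_iff)
  have uw: "u w w = of_real (Re (u w w))" using u by (simp add: complex_nonneg_Reals_iff complex_eq_iff)
  have "k w w = of_real (1 / (1 - Re (u w w)))"
    unfolding k_eq by (subst uw) simp
  moreover have "k w w \<in> \<real>\<^sub>\<ge>\<^sub>0"
    using ip_nonneg[OF kernel_mem, of w] by (simp add: ip_kernel kernel_mem)
  ultimately have "0 \<le> 1 / (1 - Re (u w w))" by (metis complex_nonneg_Reals_iff Re_complex_of_real)
  moreover have "Re (u w w) \<noteq> 1" using u_ne_1[of w w] uw by auto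
  ultimately show "Re (u w w) < 1" by (simp add: zero_le_divide_1_iff)
qed

lemma q_bounds: "0 \<le> q w" "q w < 1"
  using Re_u_diag[of w] by (auto simp: q_def)

lemma u_diag: "u w w = of_real ((q w)\<^sup>2)"
  using u_psd[of "{w}" "\<lambda>_. 1"] Re_u_diag[of w]
  by (simp add: q_def complex_nonneg_Reals_iff complex_eq_iff)

text \<open>The row contraction with a single entry.\<close>

lemma u_mult:
  assumes "g \<in> H"
  shows "(\<lambda>p. u p w * g p) \<in> H" "nrm (\<lambda>p. u p w * g p) \<le> q w * nrm g"
proof -
  show mem: "(\<lambda>p. u p w * g p) \<in> H"
    using row_contraction(1)[of "{w}" "\<lambda>_. g"] assms by simp
  have "(nrm (\<lambda>p. u p w * g p))\<^sup>2 \<le> Re (u w w * ip g g)"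
    using row_contraction(2)[of "{w}" "\<lambda>_. g"] assms by simp
  also have "\<dots> = (q w * nrm g)\<^sup>2"
    unfolding u_diag ip_self[OF assms] of_real_mult[symmetric] Re_complex_of_real
    by (rule power_mult_distrib[symmetric])
  finally show "nrm (\<lambda>p. u p w * g p) \<le> q w * nrm g"
    by (rule power2_le_imp_le) (simp add: q_bounds nrm_nonneg assms)
qed

lemma u_power_mult:
  assumes "g \<in> H"
  shows "(\<lambda>p. u p w ^ n * g p) \<in> H" "nrm (\<lambda>p. u p w ^ n * g p) \<le> q w ^ n * nrm g"
proof (induction n)
  case (Suc n)
  have eq: "(\<lambda>p. u p w ^ Suc n * g p) = (\<lambda>p. u p w * (u p w ^ n * g p))"
    by (simp add: mult.assoc)
  { case 1 show ?case unfolding eq by (rule u_mult(1)[OF Suc(1)]) }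
  { case 2
    have "nrm (\<lambda>p. u p w * (u p w ^ n * g p)) \<le> q w * nrm (\<lambda>p. u p w ^ n * g p)"
      by (rule u_mult(2)[OF Suc(1)])
    also have "\<dots> \<le> q w * (q w ^ n * nrm g)"
      by (intro mult_left_mono Suc(2) q_bounds)
    finally show ?case unfolding eq by (simp add: mult.assoc) }
qed (use assms in auto)

text \<open>The partial sums \<open>s n\<close> of the geometric series for \<open>k\<^sub>w\<close>
  times \<open>g\<close> obey a recursion that keeps their norms below the stated bound; their
  pointwise limit is then in \<open>H\<close> as well.\<close>

lemma kernel_mult:
  assumes g: "g \<in> H"
  shows "(\<lambda>p. g p * k p w) \<in> H" "nrm (\<lambda>p. g p * k p w) \<le> nrm g / (1 - q w)"
proof -
  define s where "s n = (\<lambda>p. (\<Sum>m<n. u p w ^ m) * g p)" for n :: nat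
  have s_Suc: "s (Suc n) = g + (\<lambda>p. u p w * s n p)" for n
    by (simp only: s_def sum.lessThan_Suc_shift)
      (simp add: fun_eq_iff sum_distrib_left sum_distrib_right algebra_simps)
  have s_bound: "s n \<in> H \<and> nrm (s n) \<le> nrm g / (1 - q w)" for n
  proof (induction n)
    case 0
    have "s 0 = 0" by (simp add: s_def fun_eq_iff)
    then show ?case using q_bounds[of w] g by (simp add: zero_mem nrm_zero nrm_nonneg)
  next
    case (Suc n)
    have "nrm (s (Suc n)) \<le> nrm g + nrm (\<lambda>p. u p w * s n p)"
      unfolding s_Suc using Suc g by (intro nrm_triangle u_mult) auto
    also have "\<dots> \<le> nrm g + q w * nrm (s n)"
      using u_mult(2)[of "s n" w] Suc by simp
    also have "\<dots> \<le> nrm g + q w * (nrm g / (1 - q w))"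
      using Suc q_bounds by (intro add_left_mono mult_left_mono) auto
    also have "\<dots> = nrm g / (1 - q w)"
      using q_bounds[of w] by (simp add: field_simps)
    finally have "nrm (s (Suc n)) \<le> nrm g / (1 - q w)" .
    moreover have "s (Suc n) \<in> H"
      unfolding s_Suc using Suc g by (intro add_mem u_mult) auto
    ultimately show ?case by simp
  qed
  have lim: "(\<lambda>n. s n p) \<longlonglongrightarrow> g p * k p w" for p
  proof -
    \<comment> \<open>The remainder of the geometric series tends to 0 in norm because
      \<open>q w < 1\<close>, hence at every point.\<close>
    have "(\<lambda>n. nrm ((\<lambda>p. u p w ^ n * g p) - 0)) \<longlonglongrightarrow> 0"
    proof (rule Lim_null_comparison)
      show "\<forall>\<^sub>F n in sequentially. norm (nrm ((\<lambda>p. u p w ^ n * g p) - 0)) \<le> q w ^ n * nrm g"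
        using u_power_mult[OF g, of w] by (auto simp: nrm_nonneg)
      show "(\<lambda>n. q w ^ n * nrm g) \<longlonglongrightarrow> 0"
        using q_bounds[of w] by (intro tendsto_mult_left_zero LIMSEQ_realpow_zero) auto
    qed
    from eval_limit[OF u_power_mult(1)[OF g] zero_mem(1) this, of p]
    have "(\<lambda>n. u p w ^ n * g p) \<longlonglongrightarrow> 0" by simp
    then have "(\<lambda>n. k p w * (g p - u p w ^ n * g p)) \<longlonglongrightarrow> k p w * (g p - 0)"
      by (intro tendsto_intros)
    moreover have "s n p = k p w * (g p - u p w ^ n * g p)" for n
      using u_ne_1[of p w] by (simp add: s_def k_eq sum_gp_strict field_simps)
    ultimately show ?thesis by (simp add: mult.commute)
  qed
  show "(\<lambda>p. g p * k p w) \<in> H" "nrm (\<lambda>p. g p * k p w) \<le> nrm g / (1 - q w)"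
    using bounded_pointwise_limit[of s "nrm g / (1 - q w)" "\<lambda>p. g p * k p w"] s_bound lim by auto
qed

definition v :: "('x \<Rightarrow> complex) \<Rightarrow> 'x \<Rightarrow> complex" where
  "v g z = ip g (\<lambda>p. g p * k p z)"

lemma norm_v_le: "g \<in> H \<Longrightarrow> cmod (v g z) \<le> (nrm g)\<^sup>2 / (1 - q z)"
proof -
  assume g: "g \<in> H"
  have "cmod (v g z) \<le> nrm g * nrm (\<lambda>p. g p * k p z)"
    unfolding v_def by (intro cauchy_schwarz g kernel_mult)
  also have "\<dots> \<le> nrm g * (nrm g / (1 - q z))"
    by (intro mult_left_mono kernel_mult g nrm_nonneg)
  finally show ?thesis by (simp add: power2_eq_square)
qed

lemma mult_kc:
  "(\<lambda>p. g p * kc Y a p) = (\<lambda>p. \<Sum>w\<in>Y. a w * (g p * k p w))"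
  by (simp add: kc_def sum_distrib_left mult_ac)

lemma mult_kc_mem: "g \<in> H \<Longrightarrow> (\<lambda>p. g p * kc Y a p) \<in> H"
  unfolding mult_kc by (intro lincomb_mem kernel_mult)

text \<open>Since \<open>u\<^sub>w\<close> times \<open>G w\<close> equals \<open>G w - g\<close>,
  the kernel \<open>Q\<close> is expressed through \<open>G\<close> and \<open>g\<close> alone.
  Multiplying it by \<open>k\<close> and using \<open>u k = k - 1\<close> leaves exactly the four
  terms of the inequality.\<close>

lemma key_inequality:
  assumes fin: "finite Y" and g: "g \<in> H"
  shows "(nrm (\<lambda>p. g p * kc Y a p))\<^sup>2 + (nrm g)\<^sup>2 * (nrm (kc Y a))\<^sup>2
    \<le> 2 * Re (\<Sum>z\<in>Y. cnj (a z) * (v g z * kc Y a z))"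
proof -
  define G where "G w = (\<lambda>p. g p * k p w)" for w
  have G: "G w \<in> H" for w unfolding G_def by (rule kernel_mult(1)[OF g])
  have G_diff: "G w - g = (\<lambda>p. u p w * G w p)" for w
  proof
    fix p
    have "u p w * G w p = g p * (u p w * k p w)" by (simp add: G_def)
    then show "(G w - g) p = u p w * G w p" unfolding u_k by (simp add: G_def algebra_simps)
  qed
  define R where "R = (\<Sum>z\<in>Y. cnj (a z) * (v g z * kc Y a z))"
  define Q where "Q z w = u z w * ip (G w) (G z) - ip (G w - g) (G z - g)" for z w
  have "0 \<le> Re (\<Sum>z\<in>Y. \<Sum>w\<in>Y. Q z w * ip (\<lambda>p. a w * k p w) (\<lambda>p. a z * k p z))"
  proof (rule Schur_product[OF fin])
    fix b :: "'x \<Rightarrow> complex"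
    let ?x = "\<lambda>w p. b w * G w p"
    have "(\<lambda>p. \<Sum>w\<in>Y. u p w * ?x w p) = (\<lambda>p. \<Sum>w\<in>Y. b w * (G w - g) p)"
      unfolding G_diff by (simp add: mult_ac)
    \<comment> \<open>Positivity of \<open>Q\<close>: the row contraction applied to the vectors
      \<open>b w * G w\<close>.\<close>
    then have "(nrm (\<lambda>p. \<Sum>w\<in>Y. b w * (G w - g) p))\<^sup>2 \<le> Re (\<Sum>z\<in>Y. \<Sum>w\<in>Y. u z w * ip (?x w) (?x z))"
      using row_contraction(2)[of Y ?x] fin G scale_mem by simp
    moreover have "ip (\<lambda>p. \<Sum>w\<in>Y. b w * (G w - g) p) (\<lambda>p. \<Sum>w\<in>Y. b w * (G w - g) p)
        = (\<Sum>z\<in>Y. \<Sum>w\<in>Y. cnj (b z) * b w * ip (G w - g) (G z - g))"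
      by (subst ip_lincomb_right)
        (simp_all add: ip_lincomb_left lincomb_mem G g diff_mem sum_distrib_left mult_ac
          del: minus_apply)
    moreover have "(\<Sum>z\<in>Y. \<Sum>w\<in>Y. u z w * ip (?x w) (?x z))
        = (\<Sum>z\<in>Y. \<Sum>w\<in>Y. cnj (b z) * b w * (u z w * ip (G w) (G z)))"
      by (simp add: ip_scale_left ip_scale_right scale_mem G mult_ac)
    ultimately have "Re (\<Sum>z\<in>Y. \<Sum>w\<in>Y. cnj (b z) * b w * ip (G w - g) (G z - g))
        \<le> Re (\<Sum>z\<in>Y. \<Sum>w\<in>Y. cnj (b z) * b w * (u z w * ip (G w) (G z)))"
      by (simp only: nrm_sq lincomb_mem G g diff_mem)
    then show "0 \<le> Re (\<Sum>z\<in>Y. \<Sum>w\<in>Y. cnj (b z) * b w * Q z w)"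
      unfolding Q_def by (simp only: right_diff_distrib sum_subtractf minus_complex.sel)
  qed (intro scale_mem kernel_mem)
  also have "(\<Sum>z\<in>Y. \<Sum>w\<in>Y. Q z w * ip (\<lambda>p. a w * k p w) (\<lambda>p. a z * k p z))
      = (\<Sum>z\<in>Y. \<Sum>w\<in>Y. cnj (a z) * a w * k z w * cnj (v g w) + cnj (a z) * (v g z * (a w * k z w))
          - ip g g * (cnj (a z) * a w * k z w) - cnj (a z) * a w * ip (G w) (G z))"
  proof (intro sum.cong refl)
    fix z w
    have "ip (G w) g = cnj (v g w)" "ip g (G z) = v g z"
      unfolding v_def G_def[symmetric] by (auto intro: ip_commute g G)
    then have "Q z w * k z w = (u z w * k z w) * ip (G w) (G z)
        - k z w * (ip (G w) (G z) - cnj (v g w) - v g z + ip g g)"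
      unfolding Q_def by (simp add: ip_diff_left ip_diff_right g G diff_mem algebra_simps)
    \<comment> \<open>The terms \<open>k z w * ip (G w) (G z)\<close> cancel.\<close>
    then have Qk: "Q z w * k z w = k z w * cnj (v g w) + k z w * v g z - k z w * ip g g - ip (G w) (G z)"
      unfolding u_k by (simp add: algebra_simps)
    have "Q z w * ip (\<lambda>p. a w * k p w) (\<lambda>p. a z * k p z) = cnj (a z) * a w * (Q z w * k z w)"
      by (simp add: ip_scale_left ip_scale_right kernel_mem scale_mem ip_kernel)
    then show "Q z w * ip (\<lambda>p. a w * k p w) (\<lambda>p. a z * k p z)
      = cnj (a z) * a w * k z w * cnj (v g w) + cnj (a z) * (v g z * (a w * k z w))
          - ip g g * (cnj (a z) * a w * k z w) - cnj (a z) * a w * ip (G w) (G z)"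
      unfolding Qk by (simp add: algebra_simps)
  qed
  also have "\<dots> = (\<Sum>z\<in>Y. \<Sum>w\<in>Y. cnj (a z) * a w * k z w * cnj (v g w))
      + (\<Sum>z\<in>Y. \<Sum>w\<in>Y. cnj (a z) * (v g z * (a w * k z w)))
      - ip g g * (\<Sum>z\<in>Y. \<Sum>w\<in>Y. cnj (a z) * a w * k z w)
      - (\<Sum>z\<in>Y. \<Sum>w\<in>Y. cnj (a z) * a w * ip (G w) (G z))"
    by (simp add: sum.distrib sum_subtractf sum_distrib_left)
  also have "(\<Sum>z\<in>Y. \<Sum>w\<in>Y. cnj (a z) * (v g z * (a w * k z w))) = R"
    by (simp add: R_def kc_def sum_distrib_left)
  also have "(\<Sum>z\<in>Y. \<Sum>w\<in>Y. cnj (a z) * a w * k z w * cnj (v g w)) = cnj R"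
  proof -
    have "(\<Sum>z\<in>Y. \<Sum>w\<in>Y. cnj (a z) * a w * k z w * cnj (v g w))
        = (\<Sum>w\<in>Y. \<Sum>z\<in>Y. cnj (a z) * a w * k z w * cnj (v g w))"
      by (rule sum.swap)
    also have "\<dots> = (\<Sum>w\<in>Y. \<Sum>z\<in>Y. cnj (cnj (a w) * (v g w * (a z * k w z))))"
      by (intro sum.cong refl) (subst kernel_commute, simp add: mult_ac)
    finally show ?thesis by (simp add: R_def kc_def sum_distrib_left)
  qed
  also have "(\<Sum>z\<in>Y. \<Sum>w\<in>Y. cnj (a z) * a w * k z w) = of_real ((nrm (kc Y a))\<^sup>2)"
    unfolding ip_kc_kc[symmetric] by (rule ip_self[OF kc_mem])
  also have "(\<Sum>z\<in>Y. \<Sum>w\<in>Y. cnj (a z) * a w * ip (G w) (G z)) = of_real ((nrm (\<lambda>p. g p * kc Y a p))\<^sup>2)"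
  proof -
    have "(\<lambda>p. g p * kc Y a p) = (\<lambda>p. \<Sum>w\<in>Y. a w * G w p)"
      unfolding mult_kc G_def ..
    moreover have "ip (\<lambda>p. \<Sum>w\<in>Y. a w * G w p) (\<lambda>p. \<Sum>w\<in>Y. a w * G w p)
        = (\<Sum>z\<in>Y. \<Sum>w\<in>Y. cnj (a z) * a w * ip (G w) (G z))"
      by (subst ip_lincomb_right)
        (simp_all add: ip_lincomb_left lincomb_mem G sum_distrib_left mult_ac)
    ultimately show ?thesis
      using ip_self[OF mult_kc_mem[OF g, of Y a]] by simp
  qed
  also have "ip g g = of_real ((nrm g)\<^sup>2)" by (rule ip_self[OF g])
  finally show ?thesis unfolding R_def[symmetric] by simp
qed

end

section \<open>Contractive multipliers with bounded columns\<close>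

context kernel_space
begin

text \<open>Pointwise convergence is convergence of the pairings with kernel sums; these are dense,
  and the bound \<open>R\<close> controls the approximation error uniformly in
  \<open>n\<close>.\<close>

lemma weak_limit:
  assumes x: "\<And>n::nat. x n \<in> H" "\<And>n. nrm (x n) \<le> R" and f: "f \<in> H"
    and lim: "\<And>p. (\<lambda>n. x n p) \<longlonglongrightarrow> f p" and g: "g \<in> H"
  shows "(\<lambda>n. ip (x n) g) \<longlonglongrightarrow> ip f g"
proof (rule LIMSEQ_I)
  fix e :: real assume "e > 0"
  \<comment> \<open>Bounds the norm of every \<open>x n - f\<close> and is positive, so that one may
    divide by it.\<close>
  define B where "B = R + nrm f + 1"
  have "0 \<le> R" using x nrm_nonneg order_trans by blast
  then have B: "0 < B" using nrm_nonneg[OF f] by (simp add: B_def)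
  obtain Y a where fin: "\<And>n. finite (Y n)" and dense: "(\<lambda>n::nat. nrm (kc (Y n) (a n) - g)) \<longlonglongrightarrow> 0"
    using kernel_dense[OF g] by blast
  have "0 < e / (2 * B)" using B \<open>e > 0\<close> by simp
  from LIMSEQ_D[OF dense this] obtain m where "norm (nrm (kc (Y m) (a m) - g) - 0) < e / (2 * B)"
    by blast
  then have m: "nrm (g - kc (Y m) (a m)) < e / (2 * B)"
    using nrm_minus[OF diff_mem[OF kc_mem g], of "Y m" "a m"] by simp
  have "(\<lambda>n. ip (x n - f) (kc (Y m) (a m))) \<longlonglongrightarrow> (\<Sum>w\<in>Y m. cnj (a m w) * (f w - f w))"
    unfolding ip_kc[OF diff_mem[OF x(1) f]] minus_apply by (intro tendsto_intros lim)
  then have "(\<lambda>n. ip (x n - f) (kc (Y m) (a m))) \<longlonglongrightarrow> 0" by simp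
  moreover have "0 < e / 2" using \<open>e > 0\<close> by simp
  ultimately obtain N where N: "\<And>n. n \<ge> N \<Longrightarrow> norm (ip (x n - f) (kc (Y m) (a m)) - 0) < e / 2"
    using LIMSEQ_D by blast
  show "\<exists>no. \<forall>n\<ge>no. norm (ip (x n) g - ip f g) < e"
  proof (intro exI allI impI)
    fix n assume n: "n \<ge> N"
    have xf: "x n - f \<in> H" by (intro diff_mem x f)
    have gk: "g - kc (Y m) (a m) \<in> H" by (intro diff_mem g kc_mem)
    have "ip (x n) g - ip f g = ip (x n - f) (kc (Y m) (a m)) + ip (x n - f) (g - kc (Y m) (a m))"
      by (simp add: ip_diff_left ip_diff_right x f g kc_mem diff_mem)
    then have "norm (ip (x n) g - ip f g)
        \<le> norm (ip (x n - f) (kc (Y m) (a m))) + norm (ip (x n - f) (g - kc (Y m) (a m)))"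
      using norm_triangle_ineq by metis
    also have "norm (ip (x n - f) (g - kc (Y m) (a m))) \<le> nrm (x n - f) * nrm (g - kc (Y m) (a m))"
      by (rule cauchy_schwarz[OF xf gk])
    also have "\<dots> \<le> B * (e / (2 * B))"
      using nrm_triangle_diff[OF x(1)[of n] f] x(2)[of n] m B
      by (intro mult_mono) (auto simp: B_def nrm_nonneg gk)
    also have "\<dots> = e / 2" using B by simp
    finally show "norm (ip (x n) g - ip f g) < e"
      using N[OF n] unfolding diff_0_right by linarith
  qed
qed

text \<open>As the norms do not exceed that of the limit, the squared distance is at most twice the
  squared norm of \<open>f\<close> minus twice \<open>Re (ip (x n) f)\<close>, which tends to 0 by
  weak convergence.\<close>

lemma bounded_limit:
  assumes x: "\<And>n::nat. x n \<in> H" "\<And>n. nrm (x n) \<le> nrm f" and f: "f \<in> H"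
    and lim: "\<And>p. (\<lambda>n. x n p) \<longlonglongrightarrow> f p"
  shows "(\<lambda>n. nrm (x n - f)) \<longlonglongrightarrow> 0"
proof -
  have "(\<lambda>n. (nrm (x n - f))\<^sup>2) \<longlonglongrightarrow> 0"
  proof (rule Lim_null_comparison)
    have "(nrm (x n - f))\<^sup>2 \<le> 2 * (nrm f)\<^sup>2 - 2 * Re (ip (x n) f)" for n
      using nrm_diff_sq[OF x(1) f, of n] power_mono[OF x(2)[of n] nrm_nonneg[OF x(1)], of 2] by simp
    then show "\<forall>\<^sub>F n in sequentially. norm ((nrm (x n - f))\<^sup>2) \<le> 2 * (nrm f)\<^sup>2 - 2 * Re (ip (x n) f)"
      by simp
    have "(\<lambda>n. 2 * (nrm f)\<^sup>2 - 2 * Re (ip (x n) f)) \<longlonglongrightarrow> 2 * (nrm f)\<^sup>2 - 2 * Re (ip f f)"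
      by (intro tendsto_intros weak_limit[OF x f lim f])
    then show "(\<lambda>n. 2 * (nrm f)\<^sup>2 - 2 * Re (ip (x n) f)) \<longlonglongrightarrow> 0"
      by (simp add: nrm_sq f)
  qed
  then show ?thesis by simp
qed

lemma kc_zero: "kc Y (\<lambda>_. 0) = 0"
  by (simp add: kc_def fun_eq_iff)

lemma kc_extend:
  "\<lbrakk>finite Z; Y \<subseteq> Z\<rbrakk> \<Longrightarrow> kc Z (\<lambda>w. if w \<in> Y then a w else 0) = kc Y a"
  unfolding kc_def by (intro ext sum.mono_neutral_cong_right) auto

end

text \<open>One square-summable family and a fixed \<open>\<epsilon>\<close>. For an element of the
  weak product, \<open>F\<close> will run through both families of factors, so that one function
  \<open>\<omega>\<close> serves them both.\<close>

locale column = pick_space H ip k u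
  for H :: "('x \<Rightarrow> complex) set" and ip k u +
  fixes F :: "nat \<Rightarrow> 'x \<Rightarrow> complex" and \<epsilon> :: real
  assumes F: "F i \<in> H" and F_summable: "summable (\<lambda>i. (nrm (F i))\<^sup>2)" and eps: "0 < \<epsilon>"
begin

definition V :: "'x \<Rightarrow> complex" where
  "V z = 1 + of_real \<epsilon> * (\<Sum>i. v (F i) z)"

definition \<omega> :: "'x \<Rightarrow> complex" where
  "\<omega> z = 1 / V z"

lemma summable_v: "summable (\<lambda>i. v (F i) z)"
proof (rule summable_comparison_test')
  show "norm (v (F i) z) \<le> (nrm (F i))\<^sup>2 / (1 - q z)" for i
    using norm_v_le[OF F] .
  show "summable (\<lambda>i. (nrm (F i))\<^sup>2 / (1 - q z))"
    by (intro summable_divide F_summable)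
qed

text \<open>The key inequality is summed over \<open>i\<close>; every \<open>D i\<close> is
  nonnegative, so partial sums stay below the full series. The summand 1 of \<open>V\<close>
  supplies the squared norm of \<open>kc Y a\<close>.\<close>

lemma V_lower:
  assumes "finite Y"
  shows "(nrm (kc Y a))\<^sup>2 + \<epsilon> / 2 * (\<Sum>i<n. (nrm (\<lambda>p. F i p * kc Y a p))\<^sup>2)
    \<le> Re (\<Sum>z\<in>Y. cnj (a z) * (V z * kc Y a z))"
proof -
  define D where "D i = Re (\<Sum>z\<in>Y. cnj (a z) * (v (F i) z * kc Y a z))" for i
  define T where "T = (\<Sum>z\<in>Y. cnj (a z) * ((\<Sum>i. v (F i) z) * kc Y a z))"
  have D: "(nrm (\<lambda>p. F i p * kc Y a p))\<^sup>2 \<le> 2 * D i" for i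
    using key_inequality[OF assms F, of i a] zero_le_power2[of "nrm (F i) * nrm (kc Y a)"]
    unfolding D_def power_mult_distrib by linarith
  have "(\<lambda>i. \<Sum>z\<in>Y. cnj (a z) * (v (F i) z * kc Y a z)) sums T"
    unfolding T_def by (intro sums_sum sums_mult sums_mult2 summable_sums summable_v)
  from sums_Re[OF this] have sums: "D sums Re T"
    unfolding D_def .
  have "0 \<le> D i" for i using D[of i] zero_le_power2[of "nrm (\<lambda>p. F i p * kc Y a p)"] by linarith
  then have "(\<Sum>i<n. D i) \<le> suminf D" using sums by (intro sum_le_suminf) (auto simp: sums_iff)
  moreover have "(\<Sum>i<n. (nrm (\<lambda>p. F i p * kc Y a p))\<^sup>2) \<le> 2 * (\<Sum>i<n. D i)"
    unfolding sum_distrib_left by (intro sum_mono D)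
  ultimately have "(\<Sum>i<n. (nrm (\<lambda>p. F i p * kc Y a p))\<^sup>2) \<le> 2 * Re T"
    using sums by (simp add: sums_iff)
  then have "\<epsilon> / 2 * (\<Sum>i<n. (nrm (\<lambda>p. F i p * kc Y a p))\<^sup>2) \<le> \<epsilon> / 2 * (2 * Re T)"
    using eps by (intro mult_left_mono) auto
  moreover have "(\<Sum>z\<in>Y. cnj (a z) * (V z * kc Y a z)) = ip (kc Y a) (kc Y a) + of_real \<epsilon> * T"
    by (simp add: V_def T_def ip_kc kc_mem sum_distrib_left sum.distrib algebra_simps)
  ultimately show ?thesis by (simp add: nrm_sq[OF kc_mem])
qed

text \<open>At a zero of \<open>V\<close> the lower bound would make the kernel function vanish,
  contradicting \<open>k z z \<noteq> 0\<close>.\<close>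

lemma V_ne_0: "V z \<noteq> 0"
proof
  assume "V z = 0"
  then have "(nrm (kc {z} (\<lambda>_. 1)))\<^sup>2 \<le> 0"
    using V_lower[of "{z}" "\<lambda>_. 1" 0] by simp
  then have "kc {z} (\<lambda>_. 1) = 0" by (intro nrm_eq_0 kc_mem) simp
  then have "k z z = 0" by (simp add: kc_def fun_eq_iff)
  with k_ne_0 show False by blast
qed

lemma \<omega>_V: "\<omega> z * V z = 1"
  using V_ne_0[of z] by (simp add: \<omega>_def)

text \<open>The formal adjoint of multiplication by \<open>\<omega>\<close> sends
  \<open>kc Y c\<close> to \<open>kc Y a\<close> below. In the lower bound for \<open>a\<close>,
  \<open>\<omega>\<close> cancels \<open>V\<close>, so this map is contractive on kernel sums, and
  the criterion carries this over to the multiplication.\<close>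

lemma \<omega>_contraction:
  assumes h: "h \<in> H"
  shows "(\<lambda>p. \<omega> p * h p) \<in> H" "nrm (\<lambda>p. \<omega> p * h p) \<le> nrm h"
proof -
  have bound: "2 * Re (\<Sum>w\<in>Y. cnj (c w) * (\<omega> w * h w)) \<le> (nrm h)\<^sup>2 + (nrm (kc Y c))\<^sup>2"
    if Y: "finite Y" for Y c
  proof -
    define a where "a w = cnj (\<omega> w) * c w" for w
    have "(\<Sum>z\<in>Y. cnj (a z) * (V z * kc Y a z)) = (\<Sum>z\<in>Y. cnj (c z) * ((\<omega> z * V z) * kc Y a z))"
      by (simp add: a_def mult_ac)
    also have "\<dots> = ip (kc Y a) (kc Y c)"
      by (simp add: \<omega>_V ip_kc kc_mem)
    finally have "(nrm (kc Y a))\<^sup>2 \<le> Re (ip (kc Y a) (kc Y c))"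
      using V_lower[OF Y, of a 0] by simp
    then have "(nrm (kc Y a))\<^sup>2 \<le> (nrm (kc Y c))\<^sup>2"
      using nrm_diff_sq[OF kc_mem kc_mem, of Y a Y c] zero_le_power2[of "nrm (kc Y a - kc Y c)"] by linarith
    moreover have "(\<Sum>w\<in>Y. cnj (c w) * (\<omega> w * h w)) = ip h (kc Y a)"
      by (simp add: ip_kc h a_def mult_ac)
    ultimately show ?thesis
      using nrm_diff_sq[OF h kc_mem, of Y a] zero_le_power2[of "nrm (h - kc Y a)"] by simp
  qed
  show "(\<lambda>p. \<omega> p * h p) \<in> H" by (rule kernel_criterion(1)[OF bound])
  show "nrm (\<lambda>p. \<omega> p * h p) \<le> nrm h"
    using kernel_criterion(2)[OF bound] nrm_nonneg[OF h] by (rule power2_le_imp_le)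
qed

text \<open>The same duality for the column of the products \<open>F i * \<omega>\<close>:
  \<open>kc Y a\<close> is the formal adjoint of the column applied to the tuple of the
  \<open>kc Y (c i)\<close>.\<close>

lemma column_bound_aux:
  assumes h: "h \<in> H" and Y: "finite Y"
  shows "2 * Re (\<Sum>i<n. \<Sum>w\<in>Y. cnj (c i w) * (F i w * (\<omega> w * h w)))
    \<le> (nrm h)\<^sup>2 / (2 * \<epsilon>) + (\<Sum>i<n. (nrm (kc Y (c i)))\<^sup>2)"
proof -
  define a where "a w = (\<Sum>i<n. cnj (\<omega> w) * cnj (F i w) * c i w)" for w
  define X where "X = (nrm (kc Y a))\<^sup>2"
  define A where "A i = nrm (\<lambda>p. F i p * kc Y a p)" for i
  define B where "B i = nrm (kc Y (c i))" for i
  have Fk: "(\<lambda>p. F i p * kc Y a p) \<in> H" for i by (rule mult_kc_mem[OF F])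
  have "(\<Sum>z\<in>Y. cnj (a z) * (V z * kc Y a z))
      = (\<Sum>z\<in>Y. \<Sum>i<n. cnj (c i z) * ((\<omega> z * V z) * (F i z * kc Y a z)))"
    by (simp add: a_def sum_distrib_left sum_distrib_right mult_ac)
  also have "\<dots> = (\<Sum>i<n. \<Sum>z\<in>Y. cnj (c i z) * (F i z * kc Y a z))"
    unfolding \<omega>_V mult_1_left by (rule sum.swap)
  also have "\<dots> = (\<Sum>i<n. ip (\<lambda>p. F i p * kc Y a p) (kc Y (c i)))"
    by (simp add: ip_kc Fk)
  finally have "Re (\<Sum>z\<in>Y. cnj (a z) * (V z * kc Y a z))
      = (\<Sum>i<n. Re (ip (\<lambda>p. F i p * kc Y a p) (kc Y (c i))))" by simp
  also have "\<dots> \<le> (\<Sum>i<n. A i * B i)"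
    unfolding A_def B_def by (intro sum_mono Re_ip_le Fk kc_mem)
  \<comment> \<open>The weight is chosen so that the first summand is the column term of
    \<open>V_lower\<close> and cancels against it.\<close>
  also have "\<dots> \<le> (\<Sum>i<n. \<epsilon> / 2 * (A i)\<^sup>2 + (B i)\<^sup>2 / (2 * \<epsilon>))"
  proof (rule sum_mono)
    fix i
    have "\<epsilon> / 2 * (A i)\<^sup>2 + (B i)\<^sup>2 / (2 * \<epsilon>) - A i * B i = (\<epsilon> * A i - B i)\<^sup>2 / (2 * \<epsilon>)"
      using eps by (simp add: field_simps power2_eq_square)
    moreover have "0 \<le> (\<epsilon> * A i - B i)\<^sup>2 / (2 * \<epsilon>)" using eps by simp
    ultimately show "A i * B i \<le> \<epsilon> / 2 * (A i)\<^sup>2 + (B i)\<^sup>2 / (2 * \<epsilon>)" by linarith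
  qed
  also have "\<dots> = \<epsilon> / 2 * (\<Sum>i<n. (A i)\<^sup>2) + (\<Sum>i<n. (B i)\<^sup>2) / (2 * \<epsilon>)"
    by (simp add: sum.distrib sum_distrib_left sum_divide_distrib)
  finally have "X \<le> (\<Sum>i<n. (B i)\<^sup>2) / (2 * \<epsilon>)"
    using V_lower[OF Y, of a n] by (simp add: X_def A_def)
  then have X: "2 * \<epsilon> * X \<le> (\<Sum>i<n. (B i)\<^sup>2)" using eps by (simp add: field_simps)
  have "(\<Sum>i<n. \<Sum>w\<in>Y. cnj (c i w) * (F i w * (\<omega> w * h w)))
      = (\<Sum>w\<in>Y. \<Sum>i<n. cnj (c i w) * (F i w * (\<omega> w * h w)))"
    by (rule sum.swap)
  also have "\<dots> = ip h (kc Y a)"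
    by (simp add: ip_kc h a_def sum_distrib_left sum_distrib_right mult_ac)
  finally have "(\<Sum>i<n. \<Sum>w\<in>Y. cnj (c i w) * (F i w * (\<omega> w * h w))) = ip h (kc Y a)" .
  \<comment> \<open>Completing the square with the factor \<open>2 * \<epsilon>\<close> matches the
    bound \<open>X\<close> just obtained.\<close>
  moreover have "2 * Re (ip h (kc Y a)) \<le> (nrm h)\<^sup>2 / (2 * \<epsilon>) + 2 * \<epsilon> * X"
  proof -
    have "0 \<le> (nrm (h - (\<lambda>p. of_real (2 * \<epsilon>) * kc Y a p)))\<^sup>2" by simp
    also have "\<dots> = (nrm h)\<^sup>2 + (2 * \<epsilon>)\<^sup>2 * X - 2 * ((2 * \<epsilon>) * Re (ip h (kc Y a)))"
      using eps by (subst nrm_diff_sq) (simp_all add: h scale_mem kc_mem nrm_scale ip_scale_right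
          power_mult_distrib X_def)
    finally show ?thesis using eps by (simp add: field_simps power2_eq_square)
  qed
  ultimately show ?thesis using X by (simp add: B_def)
qed

text \<open>Applied to a tuple of length \<open>Suc i\<close> whose only nonzero entry is the last,
  the bound for tuples becomes the hypothesis of the membership criterion.\<close>

lemma column_mem:
  assumes h: "h \<in> H"
  shows "(\<lambda>p. F i p * (\<omega> p * h p)) \<in> H"
proof (rule kernel_criterion(1))
  fix Y :: "'x set" and b :: "'x \<Rightarrow> complex" assume Y: "finite Y"
  let ?c = "\<lambda>j. if j = i then b else (\<lambda>_. 0)"
  have "(\<Sum>j<Suc i. \<Sum>w\<in>Y. cnj (?c j w) * (F j w * (\<omega> w * h w)))
      = (\<Sum>w\<in>Y. cnj (b w) * (F i w * (\<omega> w * h w)))"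
    by simp
  moreover have "(\<Sum>j<Suc i. (nrm (kc Y (?c j)))\<^sup>2) = (nrm (kc Y b))\<^sup>2"
    by (simp add: kc_zero nrm_zero)
  ultimately show "2 * Re (\<Sum>w\<in>Y. cnj (b w) * (F i w * (\<omega> w * h w)))
      \<le> (nrm h)\<^sup>2 / (2 * \<epsilon>) + (nrm (kc Y b))\<^sup>2"
    using column_bound_aux[OF h Y, where n = "Suc i" and c = ?c] by (simp del: sum.lessThan_Suc)
qed

text \<open>Each entry is approximated by kernel sums, and the bound for tuples is evaluated at
  them; in the limit the pairings become squared norms.\<close>

lemma column_bound:
  assumes h: "h \<in> H"
  shows "(\<Sum>i<n. (nrm (\<lambda>p. F i p * (\<omega> p * h p)))\<^sup>2) \<le> (nrm h)\<^sup>2 / (2 * \<epsilon>)"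
proof -
  define y where "y i = (\<lambda>p. F i p * (\<omega> p * h p))" for i
  have y: "y i \<in> H" for i unfolding y_def by (rule column_mem[OF h])
  have "\<exists>Y a. (\<forall>m::nat. finite (Y m)) \<and> (\<lambda>m. nrm (kc (Y m) (a m) - y i)) \<longlonglongrightarrow> 0" for i
    using kernel_dense[OF y] by metis
  then obtain Y a where fin: "\<And>i m::nat. finite (Y i m)"
    and lim: "\<And>i. (\<lambda>m. nrm (kc (Y i m) (a i m) - y i)) \<longlonglongrightarrow> 0"
    by metis
  have "(\<Sum>i<n. (nrm (y i))\<^sup>2) \<le> (nrm h)\<^sup>2 / (2 * \<epsilon>) + (\<Sum>i<n. (nrm (kc (Y i m) (a i m) - y i))\<^sup>2)" for m
  proof -
    \<comment> \<open>The approximants of the different entries need one common finite set, to which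
      their coefficients are extended by zero.\<close>
    define Z where "Z = (\<Union>i<n. Y i m)"
    define c where "c i w = (if w \<in> Y i m then a i m w else 0)" for i w
    have Z: "finite Z" using fin by (auto simp: Z_def)
    have kc: "kc Z (c i) = kc (Y i m) (a i m)" if "i < n" for i
      unfolding c_def using that by (intro kc_extend Z) (auto simp: Z_def)
    have "(\<Sum>i<n. \<Sum>w\<in>Z. cnj (c i w) * (F i w * (\<omega> w * h w))) = (\<Sum>i<n. ip (y i) (kc Z (c i)))"
      by (simp add: ip_kc y) (simp add: y_def)
    then have "2 * Re (\<Sum>i<n. ip (y i) (kc Z (c i))) \<le> (nrm h)\<^sup>2 / (2 * \<epsilon>) + (\<Sum>i<n. (nrm (kc Z (c i)))\<^sup>2)"
      using column_bound_aux[OF h Z, where n = n and c = c] by simp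
    moreover have "(\<Sum>i<n. (nrm (kc Z (c i) - y i))\<^sup>2)
        = (\<Sum>i<n. (nrm (kc Z (c i)))\<^sup>2) + (\<Sum>i<n. (nrm (y i))\<^sup>2) - 2 * Re (\<Sum>i<n. ip (y i) (kc Z (c i)))"
      by (simp add: nrm_diff_sq kc_mem y Re_ip_commute sum.distrib sum_subtractf sum_distrib_left)
    moreover have "(\<Sum>i<n. (nrm (kc Z (c i) - y i))\<^sup>2) = (\<Sum>i<n. (nrm (kc (Y i m) (a i m) - y i))\<^sup>2)"
      by (simp add: kc)
    ultimately show ?thesis by linarith
  qed
  moreover have "(\<lambda>m. (nrm h)\<^sup>2 / (2 * \<epsilon>) + (\<Sum>i<n. (nrm (kc (Y i m) (a i m) - y i))\<^sup>2))
      \<longlonglongrightarrow> (nrm h)\<^sup>2 / (2 * \<epsilon>) + (\<Sum>i<n. 0\<^sup>2)"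
    by (intro tendsto_intros lim)
  ultimately have "(\<Sum>i<n. (nrm (y i))\<^sup>2) \<le> (nrm h)\<^sup>2 / (2 * \<epsilon>) + (\<Sum>i<n. 0\<^sup>2)"
    by (intro LIMSEQ_le_const) auto
  then show ?thesis by (simp add: y_def)
qed

end

section \<open>Multipliers tending strongly to the identity\<close>

context pick_space
begin

text \<open>The construction is carried out for every \<open>\<epsilon> n = 1 / (n + 1)\<close>. The
  column bounds \<open>K n\<close> may grow, but contractivity is uniform in \<open>n\<close> and so
  yields norm convergence from pointwise convergence.\<close>

lemma column_multipliers:
  assumes F: "\<And>i::nat. F i \<in> H" and F_summable: "summable (\<lambda>i. (nrm (F i))\<^sup>2)"
  obtains \<omega> :: "nat \<Rightarrow> 'x \<Rightarrow> complex" and K :: "nat \<Rightarrow> real" where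
    "\<And>n h. h \<in> H \<Longrightarrow> \<omega> n * h \<in> H" "\<And>n h. h \<in> H \<Longrightarrow> nrm (\<omega> n * h) \<le> nrm h"
    "\<And>n h i. h \<in> H \<Longrightarrow> F i * (\<omega> n * h) \<in> H"
    "\<And>n h N. h \<in> H \<Longrightarrow> (\<Sum>i<N. (nrm (F i * (\<omega> n * h)))\<^sup>2) \<le> K n * (nrm h)\<^sup>2"
    "\<And>h. h \<in> H \<Longrightarrow> (\<lambda>n. nrm (\<omega> n * h - h)) \<longlonglongrightarrow> 0"
proof -
  define \<epsilon> where "\<epsilon> n = inverse (real (Suc n))" for n
  have col: "column H ip k u F (\<epsilon> n)" for n
    by unfold_locales (use F F_summable in \<open>auto simp: \<epsilon>_def\<close>)
  define \<omega> where "\<omega> n = column.\<omega> ip k F (\<epsilon> n)" for n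
  have prod: "f * g = (\<lambda>p. f p * g p)" for f g :: "'x \<Rightarrow> complex"
    by (simp add: fun_eq_iff)
  have contr: "\<omega> n * h \<in> H" "nrm (\<omega> n * h) \<le> nrm h" if "h \<in> H" for n h
    using column.\<omega>_contraction[OF col that] unfolding prod \<omega>_def by auto
  show ?thesis
  proof (rule that)
    show "\<omega> n * h \<in> H" "nrm (\<omega> n * h) \<le> nrm h" if "h \<in> H" for n h
      using contr[OF that] .
    show "F i * (\<omega> n * h) \<in> H" if "h \<in> H" for n h i
      using column.column_mem[OF col that] unfolding prod \<omega>_def .
    show "(\<Sum>i<N. (nrm (F i * (\<omega> n * h)))\<^sup>2) \<le> (1 / (2 * \<epsilon> n)) * (nrm h)\<^sup>2" if "h \<in> H" for n h N
      using column.column_bound[OF col that] unfolding prod \<omega>_def by simp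
    show "(\<lambda>n. nrm (\<omega> n * h - h)) \<longlonglongrightarrow> 0" if h: "h \<in> H" for h
    proof (rule bounded_limit)
      fix p
      have eps_lim: "(\<lambda>n. of_real (\<epsilon> n) :: complex) \<longlonglongrightarrow> of_real 0"
        unfolding \<epsilon>_def by (intro tendsto_of_real LIMSEQ_inverse_real_of_nat)
      have "(\<lambda>n. 1 / (1 + of_real (\<epsilon> n) * (\<Sum>i. v (F i) p)) * h p)
          \<longlonglongrightarrow> 1 / (1 + of_real 0 * (\<Sum>i. v (F i) p)) * h p"
        by (intro tendsto_mult tendsto_divide tendsto_add tendsto_const eps_lim) simp
      then show "(\<lambda>n. (\<omega> n * h) p) \<longlonglongrightarrow> h p"
        by (simp add: \<omega>_def column.\<omega>_def[OF col] column.V_def[OF col])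
    qed (use contr h in auto)
  qed
qed

end

section \<open>The weak product\<close>

text \<open>Serves both to add two representations and to merge the two families of factors of one
  representation.\<close>

definition interleave :: "(nat \<Rightarrow> 'a) \<Rightarrow> (nat \<Rightarrow> 'a) \<Rightarrow> nat \<Rightarrow> 'a" where
  "interleave f g n = (if even n then f (n div 2) else g ((n - 1) div 2))"

lemma interleave_even: "interleave f g (2 * n) = f n"
  and interleave_odd: "interleave f g (Suc (2 * n)) = g n"
  by (simp_all add: interleave_def)

lemma sums_interleave_real:
  fixes f g :: "nat \<Rightarrow> real"
  shows "\<lbrakk>f sums x; g sums y\<rbrakk> \<Longrightarrow> interleave f g sums (x + y)"
  using sums_if[of g y f x] unfolding interleave_def by (simp add: add.commute)

lemma sums_interleave_complex:
  fixes f g :: "nat \<Rightarrow> complex"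
  assumes "f sums x" "g sums y"
  shows "interleave f g sums (x + y)"
proof -
  have "(\<lambda>n. Re (interleave f g n)) = interleave (\<lambda>n. Re (f n)) (\<lambda>n. Re (g n))"
    "(\<lambda>n. Im (interleave f g n)) = interleave (\<lambda>n. Im (f n)) (\<lambda>n. Im (g n))"
    by (auto simp: interleave_def fun_eq_iff)
  then show ?thesis
    using assms by (simp add: sums_complex_iff sums_interleave_real)
qed

lemma interleave_binary:
  "(\<lambda>n. op (interleave f g n) (interleave f' g' n)) = interleave (\<lambda>n. op (f n) (f' n)) (\<lambda>n. op (g n) (g' n))"
  by (auto simp: interleave_def fun_eq_iff)

text \<open>Recovers a bound for each of two interleaved columns from a bound for the merged
  one.\<close>

lemma sum_even_le:
  fixes a :: "nat \<Rightarrow> real"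
  assumes "\<And>n. 0 \<le> a n"
  shows "(\<Sum>i<n. a (2 * i)) \<le> (\<Sum>i<2 * n. a i)" "(\<Sum>i<n. a (Suc (2 * i))) \<le> (\<Sum>i<2 * n. a i)"
proof (induction n)
  case (Suc n)
  have "(\<Sum>i<2 * Suc n. a i) = (\<Sum>i<2 * n. a i) + a (2 * n) + a (Suc (2 * n))"
    by simp
  moreover note Suc assms[of "2 * n"] assms[of "Suc (2 * n)"]
  ultimately show "(\<Sum>i<Suc n. a (2 * i)) \<le> (\<Sum>i<2 * Suc n. a i)"
    "(\<Sum>i<Suc n. a (Suc (2 * i))) \<le> (\<Sum>i<2 * Suc n. a i)" by (simp_all del: mult_Suc_right)
qed simp_all

section \<open>The weak product, its norm and its multipliers\<close>

context hilbert_function_space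
begin

abbreviation WP where "WP \<equiv> weak_product H ip"
abbreviation WN where "WN \<equiv> weak_norm H ip"

lemma weak_representationI:
  assumes "\<And>i. f i \<in> H" "\<And>i. g i \<in> H" "summable (\<lambda>i. nrm (f i) * nrm (g i))"
    and "\<And>x. (\<lambda>i. f i x * g i x) sums h x"
  shows "weak_representation H ip h f g"
  using assms by (simp add: weak_representation_def)

lemma weak_representationD:
  assumes "weak_representation H ip h f g"
  shows "f i \<in> H" "g i \<in> H" "summable (\<lambda>i. nrm (f i) * nrm (g i))"
    "(\<lambda>i. f i x * g i x) sums h x" "h \<in> WP"
  using assms by (auto simp: weak_representation_def weak_product_def)

lemma nrm_mult_nonneg: "\<lbrakk>f \<in> H; g \<in> H\<rbrakk> \<Longrightarrow> 0 \<le> nrm f * nrm g"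
  by (simp add: nrm_nonneg)

lemma weak_sum_nonneg:
  assumes "weak_representation H ip h f g"
  shows "0 \<le> (\<Sum>i. nrm (f i) * nrm (g i))"
  using weak_representationD[OF assms] by (intro suminf_nonneg nrm_mult_nonneg)

lemma weak_norm_le:
  assumes "weak_representation H ip h f g"
  shows "WN h \<le> (\<Sum>i. nrm (f i) * nrm (g i))"
  unfolding weak_norm_def
proof (rule cInf_lower)
  show "bdd_below {\<Sum>i. nrm (f i) * nrm (g i) | f g. weak_representation H ip h f g}"
    using weak_sum_nonneg by (intro bdd_belowI[of _ 0]) blast
qed (use assms in blast)

lemma weak_norm_greatest:
  assumes "h \<in> WP" "\<And>f g. weak_representation H ip h f g \<Longrightarrow> c \<le> (\<Sum>i. nrm (f i) * nrm (g i))"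
  shows "c \<le> WN h"
  unfolding weak_norm_def
proof (rule cInf_greatest)
  show "{\<Sum>i. nrm (f i) * nrm (g i) | f g. weak_representation H ip h f g} \<noteq> {}"
    using assms(1) unfolding weak_product_def by blast
qed (use assms(2) in blast)

text \<open>Interleaving adds the costs of the representations exactly, as the triangle inequality
  requires.\<close>

lemma weak_representation_add:
  assumes "weak_representation H ip h f g" "weak_representation H ip h' f' g'"
  shows "weak_representation H ip (h + h') (interleave f f') (interleave g g')"
    and "(\<Sum>i. nrm (interleave f f' i) * nrm (interleave g g' i))
      = (\<Sum>i. nrm (f i) * nrm (g i)) + (\<Sum>i. nrm (f' i) * nrm (g' i))"
proof -
  note D = weak_representationD[OF assms(1)] and D' = weak_representationD[OF assms(2)]
  have "(\<lambda>i. nrm (interleave f f' i) * nrm (interleave g g' i))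
      sums ((\<Sum>i. nrm (f i) * nrm (g i)) + (\<Sum>i. nrm (f' i) * nrm (g' i)))"
    unfolding interleave_binary[of "\<lambda>f g. nrm f * nrm g"]
    by (intro sums_interleave_real summable_sums D(3) D'(3))
  then show "(\<Sum>i. nrm (interleave f f' i) * nrm (interleave g g' i))
      = (\<Sum>i. nrm (f i) * nrm (g i)) + (\<Sum>i. nrm (f' i) * nrm (g' i))"
    and "weak_representation H ip (h + h') (interleave f f') (interleave g g')"
    using sums_interleave_complex[OF D(4) D'(4)] D D'
    by (auto intro!: weak_representationI simp: sums_iff interleave_binary[of "\<lambda>f g. f _ * g _"])
      (auto simp: interleave_def)
qed

lemma weak_representation_minus:
  assumes "weak_representation H ip h f g"
  shows "weak_representation H ip (- h) (\<lambda>i. - f i) g"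
    "(\<Sum>i. nrm (- f i) * nrm (g i)) = (\<Sum>i. nrm (f i) * nrm (g i))"
proof -
  note D = weak_representationD[OF assms]
  show "weak_representation H ip (- h) (\<lambda>i. - f i) g"
    using D(1-3) sums_minus[OF D(4)]
    by (intro weak_representationI) (auto simp: nrm_minus uminus_mem)
  show "(\<Sum>i. nrm (- f i) * nrm (g i)) = (\<Sum>i. nrm (f i) * nrm (g i))"
    using D(1) by (simp add: nrm_minus)
qed

lemma weak_representation_zero: "weak_representation H ip 0 (\<lambda>_. 0) (\<lambda>_. 0)"
  by (rule weak_representationI) (auto simp: zero_mem nrm_zero)

lemma weak_diff_mem: "\<lbrakk>h \<in> WP; h' \<in> WP\<rbrakk> \<Longrightarrow> h - h' \<in> WP"
proof -
  assume "h \<in> WP" "h' \<in> WP"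
  then obtain f g f' g' where "weak_representation H ip h f g" "weak_representation H ip h' f' g'"
    unfolding weak_product_def by blast
  from weak_representation_add(1)[OF this(1) weak_representation_minus(1)[OF this(2)]]
  show ?thesis by (auto dest: weak_representationD(5))
qed

lemma weak_norm_nonneg: "h \<in> WP \<Longrightarrow> 0 \<le> WN h"
  by (rule weak_norm_greatest) (auto intro: weak_sum_nonneg)

lemma weak_norm_zero: "WN 0 = 0"
  using weak_norm_le[OF weak_representation_zero] weak_norm_nonneg
    weak_representationD(5)[OF weak_representation_zero] by (simp add: nrm_zero antisym)

lemma weak_norm_minus:
  assumes "h \<in> WP"
  shows "WN (- h) = WN h"
proof -
  have "WN (- h) \<le> WN h" if "h \<in> WP" for h
    using that by (rule weak_norm_greatest)
      (use weak_norm_le[OF weak_representation_minus(1)] weak_representation_minus(2) in metis)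
  moreover have "- h \<in> WP"
    using assms weak_representation_minus(1) unfolding weak_product_def by blast
  ultimately show ?thesis
    using assms by (metis antisym minus_minus)
qed

lemma weak_norm_triangle:
  assumes "h \<in> WP" "h' \<in> WP"
  shows "WN (h + h') \<le> WN h + WN h'"
proof -
  have *: "WN (h + h') \<le> (\<Sum>i. nrm (f i) * nrm (g i)) + (\<Sum>i. nrm (f' i) * nrm (g' i))"
    if "weak_representation H ip h f g" "weak_representation H ip h' f' g'" for f g f' g'
    using weak_norm_le[OF weak_representation_add(1)[OF that]] weak_representation_add(2)[OF that]
    by simp
  have "WN (h + h') - WN h' \<le> WN h"
  proof (rule weak_norm_greatest[OF assms(1)])
    fix f g assume fg: "weak_representation H ip h f g"
    have "WN (h + h') - (\<Sum>i. nrm (f i) * nrm (g i)) \<le> WN h'"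
      by (rule weak_norm_greatest[OF assms(2)]) (use *[OF fg] in \<open>simp add: algebra_simps\<close>)
    then show "WN (h + h') - WN h' \<le> (\<Sum>i. nrm (f i) * nrm (g i))" by simp
  qed
  then show ?thesis by simp
qed

lemma evaluation_product_bound:
  obtains C where "0 \<le> C"
    "\<And>f g. \<lbrakk>f \<in> H; g \<in> H\<rbrakk> \<Longrightarrow> norm (f x * g x) \<le> C * (nrm f * nrm g)"
proof -
  obtain C where C: "\<And>f. f \<in> H \<Longrightarrow> cmod (f x) \<le> C * nrm f"
    using evaluation_bounded by blast
  show ?thesis
  proof (rule that)
    show "0 \<le> C * C" by simp
    fix f g assume f: "f \<in> H" and g: "g \<in> H"
    have "norm (f x) * norm (g x) \<le> (C * nrm f) * (C * nrm g)"
      by (rule mult_mono[OF C[OF f] C[OF g]]) (use order_trans[OF norm_ge_zero C[OF f]] in auto)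
    then show "norm (f x * g x) \<le> C * C * (nrm f * nrm g)" by (simp add: norm_mult mult_ac)
  qed
qed

lemma norm_summable_eval:
  assumes "\<And>i::nat. f i \<in> H" "\<And>i. g i \<in> H" "summable (\<lambda>i. nrm (f i) * nrm (g i))"
  shows "summable (\<lambda>i. norm (f i x * g i x))"
proof -
  obtain C where C: "\<And>f g. \<lbrakk>f \<in> H; g \<in> H\<rbrakk> \<Longrightarrow> norm (f x * g x) \<le> C * (nrm f * nrm g)"
    using evaluation_product_bound[of x] by metis
  show ?thesis
    by (rule summable_comparison_test'[OF summable_mult[OF assms(3), of C]]) (simp add: C assms del: norm_mult)
qed

text \<open>Every representation bounds the value at \<open>x\<close> by \<open>C\<close> times its
  cost, so point evaluations are bounded in the weak norm. The constant \<open>C + 1\<close> allows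
  division.\<close>

lemma weak_norm_definite:
  assumes h: "h \<in> WP" and "WN h = 0"
  shows "h = 0"
proof
  fix x
  obtain C where "0 \<le> C" and C: "\<And>f g. \<lbrakk>f \<in> H; g \<in> H\<rbrakk> \<Longrightarrow> norm (f x * g x) \<le> C * (nrm f * nrm g)"
    using evaluation_product_bound[of x] by metis
  have "norm (h x) / (C + 1) \<le> WN h"
  proof (rule weak_norm_greatest[OF h])
    fix f g assume "weak_representation H ip h f g"
    note D = weak_representationD[OF this]
    have "norm (h x) = norm (\<Sum>i. f i x * g i x)" using D(4)[of x] by (simp add: sums_iff)
    also have "\<dots> \<le> (\<Sum>i. norm (f i x * g i x))"
      by (intro summable_norm norm_summable_eval D)
    also have "\<dots> \<le> (\<Sum>i. C * (nrm (f i) * nrm (g i)))"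
      by (intro suminf_le C D norm_summable_eval summable_mult)
    also have "\<dots> = C * (\<Sum>i. nrm (f i) * nrm (g i))"
      by (intro suminf_mult D)
    also have "\<dots> \<le> (\<Sum>i. nrm (f i) * nrm (g i)) * (C + 1)"
      using suminf_nonneg[OF D(3) nrm_mult_nonneg[OF D(1,2)]] by (simp add: algebra_simps)
    finally show "norm (h x) / (C + 1) \<le> (\<Sum>i. nrm (f i) * nrm (g i))"
      using \<open>0 \<le> C\<close> by (simp add: divide_le_eq)
  qed
  then show "h x = 0 x" using \<open>0 \<le> C\<close> assms(2) by (simp add: divide_le_0_iff)
qed

lemma weak_metric: "Metric_space WP (norm_dist WP WN)"
  by (rule norm_dist_metric)
    (auto simp: weak_diff_mem weak_norm_nonneg weak_norm_minus weak_norm_zero weak_norm_triangle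
      intro: weak_norm_definite)

text \<open>Multiplying only the left factors of a representation does not increase its
  cost.\<close>

lemma contraction_weak_multiplier:
  assumes mem: "\<And>f. f \<in> H \<Longrightarrow> \<phi> * f \<in> H" and contr: "\<And>f. f \<in> H \<Longrightarrow> nrm (\<phi> * f) \<le> nrm f"
  shows "\<phi> \<in> Mult WP"
  unfolding Mult_def
proof (intro CollectI ballI)
  fix h assume "h \<in> WP"
  then obtain f g where "weak_representation H ip h f g" unfolding weak_product_def by blast
  note D = weak_representationD[OF this]
  have "weak_representation H ip (\<phi> * h) (\<lambda>i. \<phi> * f i) g"
  proof (rule weak_representationI)
    show "summable (\<lambda>i. nrm (\<phi> * f i) * nrm (g i))"
      by (rule summable_comparison_test'[OF D(3)])
        (auto simp: abs_mult nrm_nonneg mem D intro!: mult_right_mono contr)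
    show "(\<lambda>i. (\<phi> * f i) x * g i x) sums (\<phi> * h) x" for x
      using sums_mult[OF D(4), of "\<phi> x" x] by (simp add: mult.assoc)
  qed (simp_all add: mem D)
  then show "\<phi> * h \<in> WP" by (rule weak_representationD(5))
qed

text \<open>If \<open>p\<close> is the sum of the \<open>f j * g j\<close>, then
  \<open>\<Phi> * p\<close> is the double sum of \<open>(A i * f j) * (B i * g j)\<close>. For fixed
  \<open>j\<close>, the Cauchy-Schwarz inequality in \<open>i\<close> bounds the cost by
  \<open>K\<close> times that of the \<open>j\<close>-th term.\<close>

lemma column_product_multiplier:
  fixes A B :: "nat \<Rightarrow> 'x \<Rightarrow> complex"
  assumes A: "\<And>i f. f \<in> H \<Longrightarrow> A i * f \<in> H" "\<And>f N. f \<in> H \<Longrightarrow> (\<Sum>i<N. (nrm (A i * f))\<^sup>2) \<le> K * (nrm f)\<^sup>2"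
    and B: "\<And>i f. f \<in> H \<Longrightarrow> B i * f \<in> H" "\<And>f N. f \<in> H \<Longrightarrow> (\<Sum>i<N. (nrm (B i * f))\<^sup>2) \<le> K * (nrm f)\<^sup>2"
    and abs: "\<And>x. summable (\<lambda>i. norm (A i x * B i x))" and \<Phi>: "\<And>x. (\<lambda>i. A i x * B i x) sums \<Phi> x"
  shows "\<Phi> \<in> Mult WP"
  unfolding Mult_def
proof (intro CollectI ballI)
  fix p assume "p \<in> WP"
  then obtain f g where "weak_representation H ip p f g" unfolding weak_product_def by blast
  note D = weak_representationD[OF this]
  define a where "a i j = nrm (A i * f j) * nrm (B i * g j)" for i j
  have a: "0 \<le> a i j" for i j by (simp add: a_def nrm_mult_nonneg A B D)
  have col: "(\<Sum>i<N. a i j) \<le> K * (nrm (f j) * nrm (g j))" for N j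
  proof -
    have "(\<Sum>i<N. a i j) \<le> L2_set (\<lambda>i. nrm (A i * f j)) {..<N} * L2_set (\<lambda>i. nrm (B i * g j)) {..<N}"
      using L2_set_mult_ineq[of "\<lambda>i. nrm (A i * f j)" "\<lambda>i. nrm (B i * g j)" "{..<N}"]
      by (simp add: a_def nrm_nonneg A B D)
    also have "\<dots> \<le> sqrt (K * (nrm (f j))\<^sup>2) * sqrt (K * (nrm (g j))\<^sup>2)"
      unfolding L2_set_def by (intro mult_mono real_sqrt_le_mono A B D) (auto intro!: sum_nonneg order_trans[OF _ A(2)] D)
    \<comment> \<open>If \<open>f j\<close> has nonzero norm, then \<open>K\<close> is nonnegative
      by the empty-sum case of \<open>A(2)\<close>; otherwise both sides are 0.\<close>
    also have "\<dots> = \<bar>K\<bar> * (nrm (f j) * nrm (g j))"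
      by (simp add: real_sqrt_mult nrm_nonneg D mult_ac)
    also have "\<dots> = K * (nrm (f j) * nrm (g j))"
    proof (cases "nrm (f j) = 0")
      case False
      have "0 \<le> K * (nrm (f j))\<^sup>2" using A(2)[OF D(1), of j 0] by simp
      then have "0 \<le> K" using False by (simp add: zero_le_mult_iff)
      then show ?thesis by simp
    qed simp
    finally show ?thesis .
  qed
  define f' where "f' n = A (fst (prod_decode n)) * f (snd (prod_decode n))" for n
  define g' where "g' n = B (fst (prod_decode n)) * g (snd (prod_decode n))" for n
  have mem: "f' n \<in> H" "g' n \<in> H" for n by (simp_all add: f'_def g'_def A B D)
  have summable: "summable (\<lambda>n. nrm (f' n) * nrm (g' n))"
  proof (rule summableI_nonneg_bounded)
    show "0 \<le> nrm (f' n) * nrm (g' n)" for n by (intro nrm_mult_nonneg mem)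
    fix N
    \<comment> \<open>The first \<open>N\<close> pairs of the enumeration lie in a finite rectangle,
      where the summation over \<open>i\<close> can be done first.\<close>
    obtain m where m: "fst ` prod_decode ` {..<N} \<subseteq> {..<m}"
      using finite_nat_iff_bounded[of "fst ` prod_decode ` {..<N}"] by auto
    obtain m' where m': "snd ` prod_decode ` {..<N} \<subseteq> {..<m'}"
      using finite_nat_iff_bounded[of "snd ` prod_decode ` {..<N}"] by auto
    have "(\<Sum>n<N. nrm (f' n) * nrm (g' n)) = (\<Sum>n<N. case_prod a (prod_decode n))"
      by (simp add: f'_def g'_def a_def case_prod_beta)
    also have "\<dots> = (\<Sum>ij\<in>prod_decode ` {..<N}. case_prod a ij)"
      by (simp only: sum.reindex[OF inj_prod_decode] o_def)
    also have "\<dots> \<le> (\<Sum>ij\<in>{..<m} \<times> {..<m'}. case_prod a ij)"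
    proof (rule sum_mono2)
      show "prod_decode ` {..<N} \<subseteq> {..<m} \<times> {..<m'}"
        using m m' by (intro subsetI) (simp only: mem_Times_iff, blast)
    qed (auto simp: a)
    also have "\<dots> = (\<Sum>i<m. \<Sum>j<m'. a i j)" by (rule sum.cartesian_product[symmetric])
    also have "\<dots> = (\<Sum>j<m'. \<Sum>i<m. a i j)" by (rule sum.swap)
    also have "\<dots> \<le> (\<Sum>j<m'. K * (nrm (f j) * nrm (g j)))" by (intro sum_mono col)
    also have "\<dots> \<le> (\<Sum>j. K * (nrm (f j) * nrm (g j)))"
    proof (intro sum_le_suminf summable_mult D ballI)
      show "0 \<le> K * (nrm (f j) * nrm (g j))" for j using col[of j 0] by simp
    qed simp
    finally show "(\<Sum>n<N. nrm (f' n) * nrm (g' n)) \<le> (\<Sum>j. K * (nrm (f j) * nrm (g j)))" .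
  qed
  have "weak_representation H ip (\<Phi> * p) f' g'"
  proof (rule weak_representationI[OF mem summable])
    fix x
    define \<alpha> where "\<alpha> i = A i x * B i x" for i
    define \<beta> where "\<beta> j = f j x * g j x" for j
    have \<alpha>: "(\<alpha> has_sum \<Phi> x) UNIV"
      unfolding \<alpha>_def by (intro norm_summable_imp_has_sum abs \<Phi>)
    have \<beta>: "(\<beta> has_sum p x) UNIV"
      unfolding \<beta>_def by (intro norm_summable_imp_has_sum norm_summable_eval D)
    have eq: "f' n x * g' n x = (\<lambda>(i, j). \<alpha> i * \<beta> j) (prod_decode n)" for n
      by (simp add: f'_def g'_def \<alpha>_def \<beta>_def case_prod_beta)
    \<comment> \<open>The enumerated products are absolutely summable, hence the double family is
      summable and its sum may be computed iteratively.\<close>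
    have "(\<lambda>n. (\<lambda>(i, j). \<alpha> i * \<beta> j) (prod_decode n)) summable_on UNIV"
      unfolding eq[symmetric] by (intro norm_summable_imp_summable_on norm_summable_eval mem summable)
    then have "(\<lambda>(i, j). \<alpha> i * \<beta> j) summable_on UNIV"
      using summable_on_reindex_bij_betw[OF bij_prod_decode] by blast
    then have "((\<lambda>(i, j). \<alpha> i * \<beta> j) has_sum \<Phi> x * p x) (UNIV \<times> UNIV)"
      by (intro has_sum_SigmaI[where g = "\<lambda>i. \<alpha> i * p x"])
        (auto intro: has_sum_cmult_left has_sum_cmult_right \<alpha> \<beta>)
    then have "((\<lambda>n. (\<lambda>(i, j). \<alpha> i * \<beta> j) (prod_decode n)) has_sum \<Phi> x * p x) UNIV"
      using has_sum_reindex_bij_betw[OF bij_prod_decode] by (metis UNIV_Times_UNIV)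
    then show "(\<lambda>n. f' n x * g' n x) sums (\<Phi> * p) x"
      unfolding eq[symmetric] by (auto dest: has_sum_imp_sums)
  qed
  then show "\<Phi> * p \<in> WP" by (rule weak_representationD(5))
qed

text \<open>Shifting a positive scalar from one factor to the other equalizes the norms; if one
  factor is 0, both are replaced by 0.\<close>

lemma balanced_factors:
  assumes f: "f \<in> H" and g: "g \<in> H"
  obtains f' g' where "f' \<in> H" "g' \<in> H" "\<And>x. f' x * g' x = f x * g x"
    "(nrm f')\<^sup>2 = nrm f * nrm g" "(nrm g')\<^sup>2 = nrm f * nrm g"
proof (cases "nrm f = 0 \<or> nrm g = 0")
  case True
  then have "f = 0 \<or> g = 0" using f g nrm_eq_0 by blast
  then show ?thesis using that[of 0 0] True by (auto simp: zero_mem nrm_zero)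
next
  case False
  define c where "c = sqrt (nrm g / nrm f)"
  have pos: "0 < nrm f" "0 < nrm g" using False nrm_nonneg f g by fastforce+
  then have c: "0 < c" "c\<^sup>2 = nrm g / nrm f" by (simp_all add: c_def)
  show ?thesis
  proof (rule that)
    let ?f = "\<lambda>x. of_real c * f x" and ?g = "\<lambda>x. of_real (1 / c) * g x"
    show "?f \<in> H" "?g \<in> H" by (intro scale_mem f g)+
    show "?f x * ?g x = f x * g x" for x using c by simp
    have "nrm ?f = c * nrm f" "nrm ?g = (1 / c) * nrm g"
      by (subst nrm_scale; use f g c in \<open>simp add: norm_divide\<close>)+
    then show "(nrm ?f)\<^sup>2 = nrm f * nrm g" "(nrm ?g)\<^sup>2 = nrm f * nrm g"
      using pos by (simp_all only: power_mult_distrib power_divide c(2) power_one)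
        (simp_all add: power2_eq_square)
  qed
qed

text \<open>Turns summability of the products of norms into square summability of each family, which
  the column construction requires.\<close>

lemma balanced_representation:
  assumes "h \<in> WP"
  obtains f g where "weak_representation H ip h f g"
    "summable (\<lambda>i. (nrm (f i))\<^sup>2)" "summable (\<lambda>i. (nrm (g i))\<^sup>2)"
proof -
  obtain f g where "weak_representation H ip h f g" using assms unfolding weak_product_def by blast
  note D = weak_representationD[OF this]
  have "\<exists>f' g'. f' \<in> H \<and> g' \<in> H \<and> (\<forall>x. f' x * g' x = f i x * g i x)
      \<and> (nrm f')\<^sup>2 = nrm (f i) * nrm (g i) \<and> (nrm g')\<^sup>2 = nrm (f i) * nrm (g i)" for i
    by (rule balanced_factors[OF D(1,2), of i]) blast
  then obtain f' g' where mem: "\<And>i. f' i \<in> H" "\<And>i. g' i \<in> H"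
    and eq: "\<And>i x. f' i x * g' i x = f i x * g i x"
    and nrm: "\<And>i. (nrm (f' i))\<^sup>2 = nrm (f i) * nrm (g i)" "\<And>i. (nrm (g' i))\<^sup>2 = nrm (f i) * nrm (g i)"
    by metis
  have "nrm (f' i) * nrm (g' i) = nrm (f i) * nrm (g i)" for i
  proof -
    have "nrm (f' i) = nrm (g' i)"
      using nrm[of i] by (intro power2_eq_imp_eq[OF _ nrm_nonneg nrm_nonneg] mem) simp
    then show ?thesis using nrm(1)[of i] by (simp add: power2_eq_square)
  qed
  then have "weak_representation H ip h f' g'"
    by (intro weak_representationI mem) (simp_all add: D eq)
  then show ?thesis using that[of f' g'] D(3) by (simp add: nrm)
qed

end

section \<open>Approximation by multipliers and density\<close>

context pick_space
begin

text \<open>The square of \<open>\<omega> n\<close> times \<open>h\<close> is the sum of the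
  products of the entries of two bounded columns, hence a multiplier. Strong convergence of
  \<open>\<omega> n\<close> acts termwise on a representation of \<open>h\<close>, and domination
  makes the costs converge.\<close>

lemma weak_multiplier_approximation:
  assumes h: "h \<in> WP"
  obtains \<omega> :: "nat \<Rightarrow> 'x \<Rightarrow> complex" where
    "\<And>n. \<omega> n \<in> Mult WP" "\<And>n. \<omega> n * (\<omega> n * h) \<in> Mult WP"
    "(\<lambda>n. WN (\<omega> n * (\<omega> n * h) - h)) \<longlonglongrightarrow> 0"
proof -
  obtain f g where "weak_representation H ip h f g"
    and fsum: "summable (\<lambda>i. (nrm (f i))\<^sup>2)" and gsum: "summable (\<lambda>i. (nrm (g i))\<^sup>2)"
    using balanced_representation[OF h] by blast
  note D = weak_representationD[OF this(1)]
  define F where "F = interleave f g"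
  have F: "F i \<in> H" for i by (simp add: F_def interleave_def D)
  have Feq: "F (2 * i) = f i" "F (Suc (2 * i)) = g i" for i
    unfolding F_def by (rule interleave_even interleave_odd)+
  have "(\<lambda>i. (nrm (F i))\<^sup>2) = interleave (\<lambda>i. (nrm (f i))\<^sup>2) (\<lambda>i. (nrm (g i))\<^sup>2)"
    by (auto simp: F_def interleave_def)
  then have Fsum: "summable (\<lambda>i. (nrm (F i))\<^sup>2)"
    using sums_interleave_real[OF summable_sums[OF fsum] summable_sums[OF gsum]] by (simp add: sums_iff)
  obtain \<omega> :: "nat \<Rightarrow> 'x \<Rightarrow> complex" and K where
    mem: "\<And>n h. h \<in> H \<Longrightarrow> \<omega> n * h \<in> H" and contr: "\<And>n h. h \<in> H \<Longrightarrow> nrm (\<omega> n * h) \<le> nrm h"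
    and col: "\<And>n h i. h \<in> H \<Longrightarrow> F i * (\<omega> n * h) \<in> H"
    and bound: "\<And>n h N. h \<in> H \<Longrightarrow> (\<Sum>i<N. (nrm (F i * (\<omega> n * h)))\<^sup>2) \<le> K n * (nrm h)\<^sup>2"
    and lim: "\<And>h. h \<in> H \<Longrightarrow> (\<lambda>n. nrm (\<omega> n * h - h)) \<longlonglongrightarrow> 0"
  proof (rule column_multipliers[of F, OF F Fsum], goal_cases)
    case (1 \<omega> K)
    show ?case by (rule 1(1)[of \<omega> K, OF 1(2-6)])
  qed
  have sq: "(\<lambda>i. (\<omega> n * f i) x * (\<omega> n * g i) x) sums (\<omega> n * (\<omega> n * h)) x" for n x
  proof -
    have "(\<lambda>i. (\<omega> n * f i) x * (\<omega> n * g i) x) = (\<lambda>i. (\<omega> n x * \<omega> n x) * (f i x * g i x))"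
      by (simp only: times_fun_apply mult_ac)
    then show ?thesis
      using sums_mult[OF D(4), of "\<omega> n x * \<omega> n x" x] by (simp only: times_fun_apply mult.assoc)
  qed
  show ?thesis
  proof (rule that)
    show "\<omega> n \<in> Mult WP" for n
      by (rule contraction_weak_multiplier[OF mem contr])
    show "\<omega> n * (\<omega> n * h) \<in> Mult WP" for n
    proof (rule column_product_multiplier[where K = "K n"])
      \<comment> \<open>One factor \<open>\<omega> n\<close> is moved next to \<open>p\<close>, so
        that the column bound applies to the entries of \<open>F\<close>.\<close>
      have eq: "\<omega> n * \<phi> * p = \<phi> * (\<omega> n * p)" for \<phi> p :: "'x \<Rightarrow> complex"
        by (simp add: fun_eq_iff mult_ac)
      fix p :: "'x \<Rightarrow> complex" assume p: "p \<in> H"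
      show "\<omega> n * f i * p \<in> H" "\<omega> n * g i * p \<in> H" for i
        using col[OF p, of "2 * i" n] col[OF p, of "Suc (2 * i)" n] by (simp_all only: eq Feq)
      show "(\<Sum>i<N. (nrm (\<omega> n * f i * p))\<^sup>2) \<le> K n * (nrm p)\<^sup>2"
        "(\<Sum>i<N. (nrm (\<omega> n * g i * p))\<^sup>2) \<le> K n * (nrm p)\<^sup>2" for N
        unfolding eq using sum_even_le[of "\<lambda>i. (nrm (F i * (\<omega> n * p)))\<^sup>2" N, OF zero_le_power2] bound[OF p, of n "2 * N"]
        unfolding Feq by linarith+
    next
      fix x
      show "(\<lambda>i. (\<omega> n * f i) x * (\<omega> n * g i) x) sums (\<omega> n * (\<omega> n * h)) x" by (rule sq)
      have "summable (\<lambda>i. norm (\<omega> n x * \<omega> n x) * norm (f i x * g i x))"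
        by (intro summable_mult norm_summable_eval D)
      then show "summable (\<lambda>i. norm ((\<omega> n * f i) x * (\<omega> n * g i) x))"
        by (simp add: norm_mult mult_ac)
    qed
    \<comment> \<open>The difference is split at \<open>\<omega> n * h\<close>; \<open>e1\<close>
      and \<open>e2\<close> are the termwise costs of the two pieces.\<close>
    define e1 where "e1 n i = nrm (\<omega> n * f i - f i) * nrm (\<omega> n * g i)" for n i
    define e2 where "e2 n i = nrm (f i) * nrm (\<omega> n * g i - g i)" for n i
    have small: "nrm (\<omega> n * p - p) \<le> 2 * nrm p" if "p \<in> H" for n p
      using nrm_triangle_diff[OF mem[OF that, of n] that] contr[OF that, of n] by simp
    have e1: "norm (e1 n i) \<le> 2 * (nrm (f i) * nrm (g i))" for n i
    proof -
      have "e1 n i \<le> (2 * nrm (f i)) * nrm (g i)" unfolding e1_def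
        by (intro mult_mono small contr) (auto simp: nrm_nonneg D mem)
      then show ?thesis by (simp add: e1_def abs_mult nrm_nonneg D mem diff_mem)
    qed
    have e2: "norm (e2 n i) \<le> 2 * (nrm (f i) * nrm (g i))" for n i
    proof -
      have "e2 n i \<le> nrm (f i) * (2 * nrm (g i))" unfolding e2_def
        by (intro mult_left_mono small) (auto simp: nrm_nonneg D)
      then show ?thesis by (simp add: e2_def abs_mult nrm_nonneg D mem diff_mem)
    qed
    have S: "summable (\<lambda>i. 2 * (nrm (f i) * nrm (g i)))" by (intro summable_mult D)
    have e1_sum: "summable (e1 n)" and e2_sum: "summable (e2 n)" for n
      using summable_comparison_test'[OF S, of 0 "e1 n"] summable_comparison_test'[OF S, of 0 "e2 n"] e1 e2
      by auto
    have WN_le: "WN (\<omega> n * (\<omega> n * h) - h) \<le> suminf (e1 n) + suminf (e2 n)" for n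
    proof -
      have fg: "(\<lambda>i. \<omega> n x * (f i x * g i x)) sums (\<omega> n x * h x)" for x
        by (intro sums_mult D)
      have 1: "weak_representation H ip (\<omega> n * (\<omega> n * h) - \<omega> n * h)
          (\<lambda>i. \<omega> n * f i - f i) (\<lambda>i. \<omega> n * g i)"
      proof (rule weak_representationI)
        show "(\<lambda>i. (\<omega> n * f i - f i) x * (\<omega> n * g i) x) sums (\<omega> n * (\<omega> n * h) - \<omega> n * h) x" for x
          using sums_diff[OF sq[of n x] fg[of x]] by (simp add: algebra_simps)
      qed (use e1_sum in \<open>simp_all add: mem D diff_mem e1_def[abs_def]\<close>)
      have 2: "weak_representation H ip (\<omega> n * h - h) f (\<lambda>i. \<omega> n * g i - g i)"
      proof (rule weak_representationI)
        show "(\<lambda>i. f i x * (\<omega> n * g i - g i) x) sums (\<omega> n * h - h) x" for x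
          using sums_diff[OF fg[of x] D(4)[of x]] by (simp add: algebra_simps)
      qed (use e2_sum in \<open>simp_all add: mem D diff_mem e2_def[abs_def]\<close>)
      have "WN ((\<omega> n * (\<omega> n * h) - \<omega> n * h) + (\<omega> n * h - h)) \<le> suminf (e1 n) + suminf (e2 n)"
        using weak_norm_triangle[OF weak_representationD(5)[OF 1] weak_representationD(5)[OF 2]]
          weak_norm_le[OF 1] weak_norm_le[OF 2] unfolding e1_def e2_def by linarith
      then show ?thesis by simp
    qed
    have e1_lim: "(\<lambda>n. e1 n i) \<longlonglongrightarrow> 0" for i
    proof (rule Lim_null_comparison)
      show "\<forall>\<^sub>F n in sequentially. norm (e1 n i) \<le> nrm (\<omega> n * f i - f i) * nrm (g i)"
        by (intro always_eventually allI)
          (auto simp: e1_def abs_mult nrm_nonneg D mem diff_mem intro!: mult_left_mono contr)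
      show "(\<lambda>n. nrm (\<omega> n * f i - f i) * nrm (g i)) \<longlonglongrightarrow> 0"
        by (intro tendsto_mult_left_zero lim D)
    qed
    have e2_lim: "(\<lambda>n. e2 n i) \<longlonglongrightarrow> 0" for i
      unfolding e2_def by (intro tendsto_mult_right_zero lim D)
    \<comment> \<open>Dominated convergence for series, with the summable majorant
      \<open>S\<close>.\<close>
    have "(\<lambda>n. suminf (e1 n)) \<longlonglongrightarrow> suminf (\<lambda>i. 0)" "(\<lambda>n. suminf (e2 n)) \<longlonglongrightarrow> suminf (\<lambda>i. 0)"
      using tannerys_theorem[of "\<lambda>i n. e1 n i" "\<lambda>_. 0" sequentially, OF e1_lim _ S]
        tannerys_theorem[of "\<lambda>i n. e2 n i" "\<lambda>_. 0" sequentially, OF e2_lim _ S] e1 e2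
      by (auto intro!: always_eventually)
    from tendsto_add[OF this] have sum_lim: "(\<lambda>n. suminf (e1 n) + suminf (e2 n)) \<longlonglongrightarrow> 0" by simp
    show "(\<lambda>n. WN (\<omega> n * (\<omega> n * h) - h)) \<longlonglongrightarrow> 0"
    proof (rule Lim_null_comparison[OF _ sum_lim])
      have "\<omega> n * (\<omega> n * h) - h \<in> WP" for n
        using contraction_weak_multiplier[OF mem contr, of n] h
        by (intro weak_diff_mem) (auto simp: Mult_def)
      then show "\<forall>\<^sub>F n in sequentially. norm (WN (\<omega> n * (\<omega> n * h) - h)) \<le> suminf (e1 n) + suminf (e2 n)"
        using WN_le weak_norm_nonneg by (intro always_eventually) simp
    qed
  qed
qed

text \<open>The approximants of \<open>h\<close> remain in \<open>M\<close> by applying invariance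
  twice, each time with the multiplier \<open>\<omega> n\<close>.\<close>

lemma invariant_subspace_multipliers_dense:
  assumes M: "invariant_subspace WP WN M"
  shows "M \<subseteq> norm_topology WP WN closure_of (M \<inter> Mult WP)"
proof
  fix h assume hM: "h \<in> M"
  interpret W: Metric_space WP "norm_dist WP WN" by (rule weak_metric)
  have MWP: "M \<subseteq> WP"
    using M closedin_subset[of W.mtopology M] unfolding invariant_subspace_def norm_topology_def by simp
  then have h: "h \<in> WP" using hM by blast
  obtain \<omega> :: "nat \<Rightarrow> 'x \<Rightarrow> complex" where \<omega>: "\<And>n. \<omega> n \<in> Mult WP"
    and prod: "\<And>n. \<omega> n * (\<omega> n * h) \<in> Mult WP"
    and lim: "(\<lambda>n. WN (\<omega> n * (\<omega> n * h) - h)) \<longlonglongrightarrow> 0"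
    using weak_multiplier_approximation[OF h] by blast
  have in_M: "\<omega> n * (\<omega> n * h) \<in> M" for n
    using M hM \<omega> unfolding invariant_subspace_def by blast
  have "\<exists>y\<in>M \<inter> Mult WP. y \<in> W.mball h r" if "r > 0" for r
  proof -
    from LIMSEQ_D[OF lim that] obtain n where "norm (WN (\<omega> n * (\<omega> n * h) - h) - 0) < r" by blast
    moreover have "\<omega> n * (\<omega> n * h) \<in> WP" using in_M MWP by blast
    ultimately have "\<omega> n * (\<omega> n * h) \<in> W.mball h r"
      using h W.commute[of h "\<omega> n * (\<omega> n * h)"] by (simp add: W.in_mball) (simp add: norm_dist_def)
    then show ?thesis using in_M prod by blast
  qed
  then show "h \<in> norm_topology WP WN closure_of (M \<inter> Mult WP)"
    using h by (simp add: norm_topology_def W.metric_closure_of)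
qed

end

theorem theorem1p2:
  fixes H :: "('x \<Rightarrow> complex) set"
    and ip :: "('x \<Rightarrow> complex) \<Rightarrow> ('x \<Rightarrow> complex) \<Rightarrow> complex"
    and k :: "'x \<Rightarrow> 'x \<Rightarrow> complex"
    and M :: "('x \<Rightarrow> complex) set"
  assumes "hilbert_function_space H ip"
    and "separable_space (norm_topology H (ip_norm ip))"
    and "reproducing_kernel H ip k"
    and "normalized_complete_Pick k"
    and "invariant_subspace (weak_product H ip) (weak_norm H ip) M"
  shows "M \<subseteq> norm_topology (weak_product H ip) (weak_norm H ip)
               closure_of (M \<inter> Mult (weak_product H ip))"
proof -
  obtain u where "positive_definite u" "\<And>z w. u z w \<noteq> 1" "\<And>z w. k z w = 1 / (1 - u z w)"
    using assms(4) unfolding normalized_complete_Pick_def by blast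
  then interpret pick_space H ip k u
    using assms(1,3) by (intro pick_space.intro kernel_space.intro pick_space_axioms.intro
      kernel_space_axioms.intro)
  show ?thesis by (rule invariant_subspace_multipliers_dense[OF assms(5)])
qed

end
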